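(* For an integer $m$, a Goldbach partition of $m$ is an unordered representation $m=p+q$ with $p,q$ odd primes (so the pair $\{p,q\}$, with $p\le q$, is counted once). For an integer $n>2$, let $\Sigma_{2n}$ be the set of all Goldbach partitions of all even integers in the interval $(4,2n]$, and equip $\Sigma_{2n}$ with the uniform probability measure $\mathbb{P}$ (each partition has probability $1/|\Sigma_{2n}|$). Let $G_n$ be the random variable defined by: $2G_n\in(4,2n]$ is the even integer partitioned by the randomly selected element of $\Sigma_{2n}$. Let $T=\max\{U_1,U_2\}$, where $U_1,U_2$ are independent random variables uniformly distributed on $(0,1)$, and let $\mu_T$ and $\sigma_T^2$ denote its mean and variance. Then, with expectation $\mathbb{E}$ and variance $\mathbb{V}ar$ taken with respect to $\mathbb{P}$, (i) $\displaystyle\lim_{n\to\infty}\frac{1}{n}\mathbb{E}(G_n)=\mu_T=\frac{2}{3}$; (ii) $\displaystyle\lim_{n\to\infty}\frac{1}{n^2}\mathbb{V}ar(G_n)=\sigma_T^2=\frac{1}{18}$.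
   Context: Equivalently, $\mathbb{P}(G_n=k)=Q_2(2k)/\sum_{2<j\le n}Q_2(2j)$ for integers $2<k\le n$, where $Q_2(2k)$ denotes the number of unordered representations of $2k$ as a sum of two odd primes. The random variable $T$ has cumulative distribution function $F(u)=0$ for $u\le 0$, $F(u)=u^2$ for $0<u<1$, $F(u)=1$ for $u\ge 1$. *)

theory Defs
  imports "HOL-Probability.Probability" "HOL-Computational_Algebra.Primes"
begin

definition goldbach_partitions :: "nat \<Rightarrow> (nat \<times> nat) set" where
  "goldbach_partitions n =
     {(p, q). prime p \<and> prime q \<and> odd p \<and> odd q \<and> p \<le> q \<and>
              4 < p + q \<and> p + q \<le> 2 * n}"

definition Goldbach_P :: "nat \<Rightarrow> (nat \<times> nat) pmf" where
  "Goldbach_P n = pmf_of_set (goldbach_partitions n)"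

definition G :: "nat \<times> nat \<Rightarrow> real" where
  "G pq = real (fst pq + snd pq) / 2"

definition U_space :: "(real \<times> real) measure" where
  "U_space = uniform_measure lborel {0<..<1} \<Otimes>\<^sub>M uniform_measure lborel {0<..<1}"

definition T :: "real \<times> real \<Rightarrow> real" where
  "T u = max (fst u) (snd u)"

definition mu_T :: real where
  "mu_T = integral\<^sup>L U_space T"

definition sigma2_T :: real where
  "sigma2_T = integral\<^sup>L U_space (\<lambda>u. (T u - mu_T)\<^sup>2)"

end

theory Submission
  imports Defs "HOL-Complex_Analysis.Complex_Analysis" "HOL-Number_Theory.Number_Theory" "HOL-Real_Asymp.Real_Asymp"
begin

text \<open>The limits encode that the number of pairs of primes \<open>(p, q)\<close> with \<open>p + q \<le> x\<close> grows like a
  regularly varying function of index 2, which is equivalent to the prime number theorem. The latter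
  follows by Newman's method: the function \<open>(s - 1) * zeta s\<close> is continued to
  \<open>Re s > 0\<close> and does not vanish for \<open>Re s \<ge> 1\<close>, because
  \<open>3 + 4 * cos x + cos (2 * x) \<ge> 0\<close>. Newman's contour argument, applied to the Dirichlet series
  with bounded coefficients \<open>psi n / n - 1\<close>, gives convergence of the sum of \<open>(psi n - n) / n\<^sup>2\<close>,
  and monotonicity of \<open>psi\<close> then forces \<open>psi n / n\<close> to tend to 1.

  Weighting each pair by \<open>ln p * ln q\<close>, the number of pairs with \<open>p + q \<le> x\<close> becomes a convolution
  of \<open>theta\<close> with itself and is asymptotic to \<open>x\<^sup>2 / 2\<close>; partial summation gives its \<open>k\<close>-th moment as
  \<open>x ^ (k + 2) / (k + 2)\<close>. Almost all weights are close to \<open>ln x ^ 2\<close>, so they cancel in the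
  quotient of two moments.\<close>

section \<open>The zeta function to the right of the imaginary axis\<close>

text \<open>Newman's argument needs bounded coefficients, and \<open>mangoldt n - 1\<close> is
  unbounded; \<open>psi n / n - 1\<close> is bounded by Chebyshev's
  \<open>psi n \<le> 4 * n\<close>. The price: the Dirichlet series of \<open>psi n / n\<close> is
  not \<open>mangoldt_series s / s\<close>, but differs from it by \<open>E (s + 1) / s\<close>,
  where E is built from the same Taylor remainders \<open>zrem\<close> that continue zeta and the
  term is holomorphic for \<open>Re s > 0\<close>. Zeta itself is never continued. With
  \<open>pole_free_zeta\<close>, whose value at 1 is 1, cancelling poles become one removable
  singularity. Zeros with \<open>Re s > 1\<close> are excluded by the logarithmic derivative instead
  of an Euler product. On the prime side, the k-th moment of ordered pairs up to X is about
  \<open>X ^ (k + 2) / ((k + 2) * ln X ^ 2)\<close>. Dividing by the case k = 0 and using that G is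
  half the sum, the mean of \<open>G ^ k / n ^ k\<close> tends to \<open>2 / (k + 2)\<close>. This
  is the integral of \<open>x ^ k * (2 * x)\<close> over (0,1), the k-th moment of T, which gives
  2/3 and 1/2 - 4/9 = 1/18. Unordered partitions halve every moment, up to a diagonal p = q of only
  O(n) pairs.\<close>

lemma
  fixes f :: "nat \<Rightarrow> complex \<Rightarrow> complex"
  assumes S: "open S"
    and hol: "\<And>n. f n holomorphic_on S"
    and bd: "\<And>x. x \<in> S \<Longrightarrow> \<exists>d>0. \<exists>h. summable h \<and> (\<forall>n. \<forall>y\<in>ball x d \<inter> S. norm (f n y) \<le> h n)"
  shows holomorphic_on_suminf: "(\<lambda>s. \<Sum>n. f n s) holomorphic_on S"
    and sums_deriv_suminf: "x \<in> S \<Longrightarrow> (\<lambda>n. deriv (f n) x) sums deriv (\<lambda>s. \<Sum>n. f n s) x"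
proof -
  have "\<exists>g g'. \<forall>x \<in> S. ((\<lambda>n. f n x) sums g x) \<and> ((\<lambda>n. deriv (f n) x) sums g' x) \<and> (g has_field_derivative g' x) (at x)"
  proof (rule series_and_derivative_comparison_complex[OF S])
    show "(f n has_field_derivative deriv (f n) x) (at x)" if "x \<in> S" for n x
      using holomorphic_derivI[OF hol S that] .
    fix x assume x: "x \<in> S"
    obtain d h where d: "d > 0" "summable h" "\<And>n y. y \<in> ball x d \<inter> S \<Longrightarrow> norm (f n y) \<le> h n"
      using bd[OF x] by blast
    have h: "h n \<ge> 0" for n using order_trans[OF norm_ge_zero d(3)[of x n]] d(1) x by auto
    show "\<exists>d h. 0 < d \<and> summable h \<and> range h \<subseteq> \<real>\<^sub>\<ge>\<^sub>0 \<and> (\<forall>\<^sub>F n in sequentially. \<forall>y\<in>ball x d \<inter> S. cmod(f n y) \<le> cmod (h n))"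
      using d h by (intro exI[of _ d] exI[of _ "\<lambda>n. complex_of_real (h n)"]) (auto simp: summable_of_real)
  qed
  then obtain g g' where g: "\<And>x. x \<in> S \<Longrightarrow> (\<lambda>n. f n x) sums g x" "\<And>x. x \<in> S \<Longrightarrow> (\<lambda>n. deriv (f n) x) sums g' x"
    "\<And>x. x \<in> S \<Longrightarrow> (g has_field_derivative g' x) (at x)" by blast
  have eq: "g x = (\<Sum>n. f n x)" if "x \<in> S" for x using g(1)[OF that] by (simp add: sums_iff)
  have der: "((\<lambda>s. \<Sum>n. f n s) has_field_derivative g' x) (at x)" if "x \<in> S" for x
    using has_field_derivative_transform_within_open[OF g(3)[OF that] S that] eq by simp
  show "(\<lambda>s. \<Sum>n. f n s) holomorphic_on S"
    using der S by (auto simp: holomorphic_on_open)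
  show "(\<lambda>n. deriv (f n) x) sums deriv (\<lambda>s. \<Sum>n. f n s) x" if "x \<in> S"
    using g(2)[OF that] DERIV_imp_deriv[OF der[OF that]] by simp
qed

lemma norm_of_nat_powr: "norm (of_nat n powr s :: complex) = real n powr Re s"
  by (subst norm_powr_real_powr) auto

text \<open>Remainder of the first-order Taylor expansion of \<open>x powr (1 - s)\<close> between \<open>n\<close> and \<open>n + 1\<close>.\<close>
definition zrem :: "nat \<Rightarrow> complex \<Rightarrow> complex" where
  "zrem n s = of_nat (Suc n) powr (1 - s) - of_nat n powr (1 - s) - (1 - s) * of_nat n powr (- s)"

lemma zrem_0: "zrem 0 s = 1"
  by (simp add: zrem_def)

lemma of_nat_powr_holomorphic: "(\<lambda>s. of_nat n powr s :: complex) holomorphic_on A"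
  by (cases "n = 0") (auto intro!: holomorphic_intros)

lemma of_nat_powr_holomorphic_compose [holomorphic_intros]:
  "f holomorphic_on A \<Longrightarrow> (\<lambda>s. of_nat n powr f s :: complex) holomorphic_on A"
  using holomorphic_on_compose_gen[OF _ of_nat_powr_holomorphic, of f A UNIV n] by (auto simp: o_def)

lemma zrem_holomorphic: "zrem n holomorphic_on A"
  unfolding zrem_def by (intro holomorphic_intros)

text \<open>The second derivative of \<open>x powr (1 - s)\<close> is
  \<open>(1 - s) * (- s) * x powr (- s - 1)\<close>. Its exponent is what makes the series of
  \<open>zrem\<close> converge for all \<open>Re s > 0\<close>.\<close>

lemma norm_zrem_le:
  assumes "Re s > 0" "n > 0"
  shows "norm (zrem n s) \<le> norm (1 - s) * norm s * real n powr (- Re s - 1)"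
proof -
  \<comment> \<open>A real ray is convex and avoids the branch cut, and on it the modulus of the
    second derivative is largest at the left end n.\<close>
  define S where "S = complex_of_real ` {real n..}"
  define f where "f = (\<lambda>i x. if i = 0 then x powr (1 - s) else if i = Suc 0 then (1 - s) * x powr (- s)
      else (1 - s) * (- s * x powr (- s - 1 :: complex)))"
  have "cmod(f 0 (of_nat (Suc n)) - (\<Sum>i\<le>1. f i (of_nat n) * (of_nat (Suc n)-of_nat n) ^ i / (fact i))) 
     \<le> (norm (1 - s) * norm s * real n powr (- Re s - 1)) * cmod(of_nat (Suc n) - of_nat n)^(Suc 1) / fact 1"
  proof (rule complex_Taylor)
    show "convex S" unfolding S_def by (rule convex_linear_image) (auto intro: bounded_linear.linear bounded_linear_of_real)
    show "of_nat n \<in> S" unfolding S_def by (intro image_eqI[of _ _ "real n"]) auto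
    show "of_nat (Suc n) \<in> S" unfolding S_def by (intro image_eqI[of _ _ "real (Suc n)"]) auto
    show "(f i has_field_derivative f (Suc i) x) (at x within S)" if "x \<in> S" "i \<le> 1" for i x
    proof -
      have x: "x \<notin> \<real>\<^sub>\<le>\<^sub>0" using that assms unfolding S_def by auto
      have "i = 0 \<or> i = 1" using that by auto
      then show ?thesis
      proof
        assume i: "i = 0"
        have "((\<lambda>z. z powr (1-s)) has_field_derivative (1 - s) * x powr (1 - s - 1)) (at x)"
          by (rule has_field_derivative_powr[OF x])
        then show ?thesis unfolding f_def using i by (simp add: has_field_derivative_at_within)
      next
        assume i: "i = 1"
        have "((\<lambda>z. z powr (-s)) has_field_derivative (- s) * x powr (- s - 1)) (at x)"
          by (rule has_field_derivative_powr[OF x])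
        from DERIV_cmult[OF this, of "1-s"] show ?thesis unfolding f_def using i
          by (simp add: has_field_derivative_at_within)
      qed
    qed
    show "cmod (f (Suc 1) x) \<le> norm (1 - s) * norm s * real n powr (- Re s - 1)" if xS: "x \<in> S" for x
    proof -
      obtain y where y: "x = of_real y" "y \<ge> real n" using xS unfolding S_def by auto
      have "norm (x powr (- s - 1)) = y powr (- Re s - 1)"
        using y assms by (subst norm_powr_real_powr) auto
      also have "\<dots> \<le> real n powr (- Re s - 1)"
        using y assms by (intro powr_mono2') auto
      finally show ?thesis unfolding f_def by (simp add: norm_mult mult_left_mono mult.assoc)
    qed
  qed
  then show ?thesis unfolding f_def zrem_def by (simp add: algebra_simps)
qed

text \<open>This is \<open>(s - 1) * zeta s\<close>: the differences in \<^const>\<open>zrem\<close> telescope. Since \<open>0 powr s = 0\<close>,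
  the summand for \<open>n = 0\<close> is 1.\<close>
definition pole_free_zeta :: "complex \<Rightarrow> complex" where
  "pole_free_zeta s = (\<Sum>n. zrem n s)"

lemma ball_Re: "y \<in> ball x d \<Longrightarrow> Re y > Re x - d" 
  using abs_Re_le_cmod[of "x - y"] by (auto simp: dist_norm)

lemma ball_norm: "y \<in> ball x d \<Longrightarrow> norm y < norm x + d" 
  using norm_triangle_ineq[of "x" "y-x"] by (auto simp: dist_norm norm_minus_commute)

lemma open_Re_gt: "open {s. Re s > c}"
  by (simp add: open_halfspace_Re_gt)

text \<open>Each power of n in the weights moves the half-plane of convergence one unit to the
  right. The case k = 0 serves zeta, the case k = 1 the weights \<open>psi n\<close>.\<close>

lemma weighted_zrem_local_bound:
  assumes "Re x > real k" and b: "\<And>n. norm (b n) \<le> C * real n ^ k"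
  shows "\<exists>d>0. \<exists>h. summable h \<and> (\<forall>n. \<forall>y\<in>ball x d \<inter> {s. Re s > real k}. norm (b n * zrem n y) \<le> h n)"
proof -
  \<comment> \<open>Half the distance to the boundary line: on the ball the real part stays above
    \<open>k + d\<close>, so the terms are at most a constant times
    \<open>n powr (- d - 1)\<close>.\<close>
  define d where "d = (Re x - real k) / 2"
  define B where "B = norm x + d"
  define h where "h = (\<lambda>n. if n = 0 then norm (b 0) else C * ((1 + B) * B * real n powr (-d - 1)))"
  have d: "d > 0" using assms d_def by auto
  have C: "C \<ge> 0" using order_trans[OF norm_ge_zero b[of 1]] by simp
  have B: "B \<ge> 0" using d by (auto simp: B_def)
  have "summable (\<lambda>n. C * ((1 + B) * B * real n powr (-d - 1)))"
    by (intro summable_mult) (use d in \<open>auto simp: summable_real_powr_iff\<close>)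
  moreover have "\<forall>\<^sub>F n in sequentially. h n = C * ((1 + B) * B * real n powr (-d - 1))"
    by (intro eventually_sequentiallyI[of 1]) (auto simp: h_def)
  ultimately have "summable h" using summable_cong by metis
  moreover have "norm (b n * zrem n y) \<le> h n" if "y\<in>ball x d \<inter> {s. Re s > real k}" for n y
  proof (cases "n = 0")
    case True then show ?thesis by (simp add: h_def zrem_0)
  next
    case False
    have y: "Re y > real k + d" "norm y \<le> B" "Re y > real k" using that ball_Re[of y x d] ball_norm[of y x d]
      by (auto simp: d_def B_def field_simps)
    have y0: "Re y > 0" using y(3) of_nat_0_le_iff[of k, where 'a = real] by linarith
    have "norm (1 - y) \<le> 1 + B" using norm_triangle_ineq4[of 1 y] y by simp
    moreover have "real n powr (- Re y - 1) \<le> real n powr (- real k - d - 1)" using False y by (intro powr_mono) auto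
    ultimately have "norm (1 - y) * norm y * real n powr (- Re y - 1) \<le> (1 + B) * B * real n powr (- real k - d - 1)"
      using y B by (intro mult_mono) auto
    then have "norm (zrem n y) \<le> (1 + B) * B * real n powr (- real k - d - 1)" using norm_zrem_le[of y n] y0 False by simp
    then have "norm (b n * zrem n y) \<le> (C * real n ^ k) * ((1 + B) * B * real n powr (- real k - d - 1))"
      unfolding norm_mult using b[of n] C by (intro mult_mono) auto
    also have "\<dots> = C * ((1 + B) * B * (real n powr real k * real n powr (- real k - d - 1)))"
      using False by (simp add: powr_realpow)
    also have "real n powr real k * real n powr (- real k - d - 1) = real n powr (- d - 1)"
      by (simp add: powr_add[symmetric])
    finally show ?thesis using False by (simp add: h_def)
  qed
  ultimately show ?thesis using d by blast
qed

lemma weighted_zrem_holomorphic: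
  assumes "\<And>n. norm (b n) \<le> C * real n ^ k"
  shows "(\<lambda>s. \<Sum>n. b n * zrem n s) holomorphic_on {s. Re s > real k}"
proof (rule holomorphic_on_suminf[OF open_Re_gt])
  show "(\<lambda>s. b n * zrem n s) holomorphic_on {s. Re s > real k}" for n
    by (intro holomorphic_intros zrem_holomorphic)
qed (rule weighted_zrem_local_bound[OF _ assms], simp_all)

lemma weighted_zrem_sums:
  assumes b: "\<And>n. norm (b n) \<le> C * real n ^ k" and s: "Re s > real k"
  shows "(\<lambda>n. b n * zrem n s) sums (\<Sum>n. b n * zrem n s)"
proof -
  obtain d h where dh: "d > 0" "summable h"
    "\<forall>n. \<forall>y\<in>ball s d \<inter> {s. Re s > real k}. norm (b n * zrem n y) \<le> h n"
    using weighted_zrem_local_bound[OF s b] by blast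
  have "summable (\<lambda>n. b n * zrem n s)"
    by (rule summable_comparison_test'[OF dh(2), of 0]) (use dh s in auto)
  then show ?thesis by (rule summable_sums)
qed

lemma pole_free_zeta_holomorphic: "pole_free_zeta holomorphic_on {s. Re s > 0}"
  using weighted_zrem_holomorphic[of "\<lambda>_. 1" 1 0] by (simp add: pole_free_zeta_def[abs_def])

text \<open>Only the term n = 0 survives at s = 1. The value is the residue of zeta at its pole; it
  later makes the poles of two series cancel.\<close>

lemma pole_free_zeta_1: "pole_free_zeta 1 = 1"
proof -
  have "(\<lambda>n. zrem n 1) = (\<lambda>n. if n = 0 then 1 else 0)"
    by (auto simp: zrem_def fun_eq_iff simp del: of_nat_Suc)
  then show ?thesis using sums_single[of 0 "\<lambda>_. 1::complex"] by (simp add: pole_free_zeta_def sums_iff)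
qed

lemma summable_of_nat_powr:
  assumes "Re s > 1"
  shows "summable (\<lambda>n. norm (of_nat n powr (-s) :: complex))"
  using assms by (simp add: norm_of_nat_powr summable_real_powr_iff)

definition zeta :: "complex \<Rightarrow> complex" where
  "zeta s = (\<Sum>n. of_nat n powr (-s))"

lemma zeta_sums: "Re s > 1 \<Longrightarrow> (\<lambda>n. of_nat n powr (-s)) sums zeta s"
  unfolding zeta_def by (rule summable_sums[OF summable_norm_cancel[OF summable_of_nat_powr]])

lemma pole_free_zeta_eq:
  assumes s: "Re s > 1"
  shows "pole_free_zeta s = (s - 1) * zeta s"
proof -
  have "(\<lambda>n. norm (of_nat n powr (1 - s) :: complex)) \<longlonglongrightarrow> 0"
    unfolding norm_of_nat_powr using s by real_asymp
  then have "(\<lambda>n. of_nat n powr (1 - s) :: complex) \<longlonglongrightarrow> 0" by (rule tendsto_norm_zero_cancel)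
  \<comment> \<open>The telescoping sum starts from \<open>0 powr (1 - s) = 0\<close>, so its total
    is 0 and only the zeta part of \<open>zrem\<close> remains.\<close>
  from telescope_sums[OF this] have "(\<lambda>n. of_nat (Suc n) powr (1 - s) - of_nat n powr (1 - s) :: complex) sums 0" by simp
  from sums_diff[OF this sums_mult[OF zeta_sums[OF s], of "1 - s"]]
  have "(\<lambda>n. zrem n s) sums (0 - (1 - s) * zeta s)" by (simp add: zrem_def)
  then show ?thesis by (simp add: pole_free_zeta_def sums_iff algebra_simps)
qed

section \<open>Dirichlet series with coefficients of logarithmic growth\<close>

lemma dirichlet_local_bound:
  assumes "Re x > 1" and b: "\<And>n. norm (b n) \<le> ln (real n + 1) * C"
  shows "\<exists>d>0. \<exists>h. summable h \<and> (\<forall>n. \<forall>y\<in>ball x d \<inter> {s. Re s > 1}. norm (b n * of_nat n powr (-y)) \<le> h n)"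
proof -
  \<comment> \<open>A third of the distance to the line \<open>Re s = 1\<close>: one third is the
    radius, which leaves \<open>Re y > 1 + 2 * d\<close>, another absorbs the logarithm, and the
    last keeps the series summable.\<close>
  define d where "d = (Re x - 1) / 3"
  have d: "d > 0" using assms d_def by auto
  have C: "C \<ge> 0" using order_trans[OF norm_ge_zero b[of 1]] by (simp add: zero_le_mult_iff)
  have "(\<lambda>n. ln (real n + 1) * real n powr (- 1 - 2 * d)) \<in> O(\<lambda>n. real n powr (-1 - d))"
    using d by real_asymp
  then have "summable (\<lambda>n. ln (real n + 1) * real n powr (- 1 - 2 * d))"
    by (rule summable_comparison_test_bigo[rotated]) (use d in \<open>simp add: summable_real_powr_iff\<close>)
  then have "summable (\<lambda>n. C * (ln (real n + 1) * real n powr (- 1 - 2 * d)))" by (rule summable_mult)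
  moreover have "norm (b n * of_nat n powr (-y)) \<le> C * (ln (real n + 1) * real n powr (- 1 - 2 * d))"
    if "y\<in>ball x d \<inter> {s. Re s > 1}" for n y
  proof (cases "n = 0")
    case False
    have "Re y > 1 + 2 * d" using that ball_Re[of y x d] by (auto simp: d_def field_simps)
    then have "real n powr (- Re y) \<le> real n powr (- 1 - 2 * d)" using False by (intro powr_mono) auto
    then have "norm (b n) * real n powr (- Re y) \<le> (ln (real n + 1) * C) * real n powr (- 1 - 2 * d)"
      using b[of n] C by (intro mult_mono) auto
    then show ?thesis by (simp add: norm_mult norm_of_nat_powr mult_ac)
  qed auto
  ultimately show ?thesis using d by blast
qed

lemma zeta_holomorphic: "zeta holomorphic_on {s. Re s > 1}"
  and zeta_deriv: "Re s > 1 \<Longrightarrow> (\<lambda>n. - of_real (ln (real n)) * of_nat n powr (-s)) sums deriv zeta s"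
proof -
  have L: "\<exists>d>0. \<exists>h. summable h \<and> (\<forall>n. \<forall>y\<in>ball x d \<inter> {s. Re s > 1}. norm (of_nat n powr (-y) :: complex) \<le> h n)"
    if x: "x \<in> {s. Re s > 1}" for x
  proof -
    \<comment> \<open>The coefficient is set to 0 at n = 0, where the bound
      \<open>ln (n + 1)\<close> vanishes; n = 1 then determines the constant
      \<open>1 / ln 2\<close>.\<close>
    have "norm (if n = 0 then 0 else 1 :: complex) \<le> ln (real n + 1) * (1 / ln 2)" for n :: nat
      by (auto simp: field_simps)
    from dirichlet_local_bound[OF _ this] x obtain d h where dh: "d > 0" "summable h" 
      "\<forall>n. \<forall>y\<in>ball x d \<inter> {s. Re s > 1}. norm ((if n = 0 then 0 else 1) * of_nat n powr (-y) :: complex) \<le> h n"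
      by blast
    have "norm (of_nat n powr (-y) :: complex) \<le> h n" if "y\<in>ball x d \<inter> {s. Re s > 1}" for n y
      using dh(3)[rule_format, OF that, of n] by (cases "n = 0") auto
    with dh show ?thesis by blast
  qed
  have H: "(\<lambda>s. of_nat n powr (-s) :: complex) holomorphic_on {s. Re s > 1}" for n
    by (intro holomorphic_intros)
  show "zeta holomorphic_on {s. Re s > 1}" unfolding zeta_def[abs_def]
    by (rule holomorphic_on_suminf[OF open_Re_gt H L])
  assume s: "Re s > 1"
  have D: "deriv (\<lambda>s. of_nat n powr (-s) :: complex) s = - of_real (ln (real n)) * of_nat n powr (-s)" for n
  proof (cases "n = 0")
    case False
    then have "((\<lambda>s. of_nat n powr (-s) :: complex) has_field_derivative - of_real (ln (real n)) * of_nat n powr (-s)) (at s)"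
      unfolding powr_def by (auto intro!: derivative_eq_intros)
    then show ?thesis by (rule DERIV_imp_deriv)
  qed auto
  show "(\<lambda>n. - of_real (ln (real n)) * of_nat n powr (-s)) sums deriv zeta s"
    using sums_deriv_suminf[OF open_Re_gt H L, of s] s unfolding D zeta_def[abs_def] by simp
qed

section \<open>The Dirichlet series of the von Mangoldt function and the logarithmic derivative of
  zeta\<close>

lemma mangoldt_le_ln_Suc: "mangoldt n \<le> ln (real n + 1)"
proof (cases "n = 0")
  case False
  then have "mangoldt n \<le> ln (real n)" by (intro mangoldt_le) auto
  also have "\<dots> \<le> ln (real n + 1)" using False by simp
  finally show ?thesis .
qed auto

definition mangoldt_series :: "complex \<Rightarrow> complex" where
  "mangoldt_series s = (\<Sum>n. mangoldt n * of_nat n powr (-s))"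

lemma mangoldt_local_bound:
  "Re x > 1 \<Longrightarrow> \<exists>d>0. \<exists>h. summable h \<and> (\<forall>n. \<forall>y\<in>ball x d \<inter> {s. Re s > 1}. norm (mangoldt n * of_nat n powr (-y) :: complex) \<le> h n)"
  by (rule dirichlet_local_bound[where C = 1]) (simp_all add: mangoldt_le_ln_Suc)

lemma mangoldt_series_holomorphic: "mangoldt_series holomorphic_on {s. Re s > 1}"
  unfolding mangoldt_series_def[abs_def]
proof (rule holomorphic_on_suminf[OF open_Re_gt])
  show "(\<lambda>s. mangoldt n * of_nat n powr (- s) :: complex) holomorphic_on {s. Re s > 1}" for n
    by (intro holomorphic_intros)
qed (rule mangoldt_local_bound, simp_all)

lemma summable_mangoldt_series: 
  assumes "Re s > 1"
  shows "summable (\<lambda>n. norm (mangoldt n * of_nat n powr (-s) :: complex))"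
proof -
  obtain d h where dh: "d > 0" "summable h"
    "\<forall>n. \<forall>y\<in>ball s d \<inter> {s. Re s > 1}. norm (mangoldt n * of_nat n powr (-y) :: complex) \<le> h n"
    using mangoldt_local_bound[OF assms] by blast
  show ?thesis
    by (rule summable_comparison_test'[OF dh(2), of 0]) (use dh assms in auto)
qed

lemma mangoldt_series_sums: "Re s > 1 \<Longrightarrow> (\<lambda>n. mangoldt n * of_nat n powr (-s)) sums mangoldt_series s"
  unfolding mangoldt_series_def by (rule summable_sums[OF summable_norm_cancel[OF summable_mangoldt_series]])

text \<open>Dirichlet convolution: \<open>mangoldt d\<close> summed over the divisors d of n is
  \<open>ln n\<close>, and \<open>- ln n * n powr (-s)\<close> are the terms of
  \<open>deriv zeta s\<close>. Unconditional sums (\<open>has_sum\<close>) allow the product of the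
  two series to be regrouped by n = d * m.\<close>

lemma deriv_zeta_eq:
  assumes s: "Re s > 1"
  shows "deriv zeta s = - zeta s * mangoldt_series s"
proof -
  define f where "f = (\<lambda>n. of_nat n powr (-s) :: complex)"
  define g where "g = (\<lambda>n. mangoldt n * of_nat n powr (-s) :: complex)"
  have f: "(f has_sum zeta s) UNIV"
    unfolding f_def by (rule norm_summable_imp_has_sum[OF summable_of_nat_powr[OF s] zeta_sums[OF s]])
  have g: "(g has_sum mangoldt_series s) UNIV"
    unfolding g_def by (rule norm_summable_imp_has_sum[OF summable_mangoldt_series[OF s] mangoldt_series_sums[OF s]])
  have "(\<lambda>n. norm (f n)) summable_on UNIV" "(\<lambda>n. norm (g n)) summable_on UNIV"
    using summable_of_nat_powr[OF s] summable_mangoldt_series[OF s]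
    by (simp_all add: f_def g_def summable_on_UNIV_nonneg_real_iff)
  then have fs: "(\<lambda>n. norm (f n)) summable_on {1..}" and gs: "(\<lambda>n. norm (g n)) summable_on {1..}"
    by (auto intro: summable_on_subset_banach)
  have f1: "(f has_sum zeta s) {1..}" using f
    by (subst has_sum_cong_neutral[of UNIV "{1..}" f f]) (auto simp: f_def)
  have g1: "(g has_sum mangoldt_series s) {1..}" using g
    by (subst has_sum_cong_neutral[of UNIV "{1..}" g g]) (auto simp: g_def)
  have "(\<lambda>(d,m). norm (g d) * norm (f m)) summable_on {1..} \<times> {1..}"
  proof (rule summable_on_SigmaI)
    show "((\<lambda>y. case (x, y) of (d, m) \<Rightarrow> norm (g d) * norm (f m)) has_sum norm (g x) * infsum (\<lambda>n. norm (f n)) {1..}) {1..}" for x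
      using has_sum_cmult_right[OF has_sum_infsum[OF fs]] by simp
  qed (use summable_on_cmult_left[OF gs] in auto)
  then have "(\<lambda>x. norm ((\<lambda>(d,m). g d * f m) x)) summable_on {1..} \<times> {1..}"
    by (simp add: case_prod_unfold norm_mult)
  then have prod_s: "(\<lambda>(d,m). g d * f m) summable_on {1..} \<times> {1..}"
    by (rule abs_summable_summable)
  have P: "((\<lambda>(d,m). g d * f m) has_sum mangoldt_series s * zeta s) ({1..} \<times> {1..})"
  proof (rule has_sum_SigmaI[where g = "\<lambda>d. g d * zeta s"])
    show "((\<lambda>y. case (x, y) of (d, m) \<Rightarrow> g d * f m) has_sum g x * zeta s) {1..}" for x
      using has_sum_cmult_right[OF f1, of "g x"] by simp
    show "((\<lambda>d. g d * zeta s) has_sum mangoldt_series s * zeta s) {1..}"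
      using has_sum_cmult_left[OF g1] .
  qed (rule prod_s)
  \<comment> \<open>Index 0 has to go: every number divides 0, so its fibre would be infinite. Its
    terms vanish, hence the restriction to \<open>{1..}\<close> changes no sum.\<close>
  define DP where "DP = (SIGMA n:{1::nat..}. {d. d dvd n})"
  have bij: "bij_betw (\<lambda>(d,m). (d * m, d)) ({1..} \<times> {1..}) DP"
    unfolding DP_def
    by (rule bij_betwI[where g = "\<lambda>(n,d). (d, n div d)"]) (auto simp: Suc_le_eq elim!: dvdE intro!: Nat.gr0I)
  have term_eq: "g d * f m = (\<lambda>(n,d). mangoldt d * of_nat n powr (-s)) (d * m, d)" if "d \<ge> 1" "m \<ge> 1" for d m
    using that powr_times_real_left[of "of_nat d" "of_nat m" "-s"]
    by (simp add: f_def g_def powr_times_real)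
  have ST: "((\<lambda>(n,d). mangoldt d * of_nat n powr (-s)) has_sum mangoldt_series s * zeta s) DP"
    using P term_eq by (subst has_sum_reindex_bij_betw[OF bij, symmetric], subst has_sum_cong[where g="\<lambda>(d,m). g d * f m"]) auto
  have Q: "((\<lambda>n. of_real (ln (real n)) * of_nat n powr (-s)) has_sum mangoldt_series s * zeta s) {1..}"
  proof (rule has_sum_SigmaD[OF ST[unfolded DP_def]])
    fix n :: nat assume n: "n \<in> {1..}"
    have "finite {d. d dvd n}" using n by auto
    from has_sum_finite[OF this, of "\<lambda>y. case (n, y) of (n, d) \<Rightarrow> mangoldt d * of_nat n powr - s"]
    show "((\<lambda>y. case (n, y) of (n, d) \<Rightarrow> mangoldt d * of_nat n powr - s) has_sum
           complex_of_real (ln (real n)) * of_nat n powr - s) {d. d dvd n}"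
      using n mangoldt_sum[of n, where 'a = complex] by (simp add: sum_distrib_right[symmetric])
  qed
  have "((\<lambda>n. of_real (ln (real n)) * of_nat n powr (-s)) has_sum mangoldt_series s * zeta s) UNIV"
    using Q by (subst has_sum_cong_neutral[of "{1..}" UNIV]) auto
  from has_sum_imp_sums[OF this] have "(\<lambda>n. of_real (ln (real n)) * of_nat n powr (-s)) sums (mangoldt_series s * zeta s)" .
  from sums_unique2[OF sums_minus[OF this]] zeta_deriv[OF s] show ?thesis by (auto simp: mult.commute)
qed

text \<open>The logarithmic derivative of \<open>(s - 1) * zeta s\<close>, kept free of denominators
  because zeros are not excluded yet.\<close>

lemma pole_free_zeta_logderiv:
  assumes s: "Re s > 1"
  shows "deriv pole_free_zeta s * (s - 1) = pole_free_zeta s * (1 - (s - 1) * mangoldt_series s)"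
proof -
  have "(zeta has_field_derivative deriv zeta s) (at s)"
    using holomorphic_derivI[OF zeta_holomorphic open_Re_gt] s by auto
  then have "((\<lambda>s. (s - 1) * zeta s) has_field_derivative (s - 1) * deriv zeta s + zeta s) (at s)"
    by (auto intro!: derivative_eq_intros)
  then have "(pole_free_zeta has_field_derivative (s - 1) * deriv zeta s + zeta s) (at s)"
    using has_field_derivative_transform_within_open[OF _ open_Re_gt[of 1]] s pole_free_zeta_eq by auto
  then have "deriv pole_free_zeta s = (s - 1) * deriv zeta s + zeta s" by (rule DERIV_imp_deriv)
  then show ?thesis using s by (simp add: pole_free_zeta_eq deriv_zeta_eq) (simp add: algebra_simps)
qed

section \<open>Non-vanishing on the line Re s = 1\<close>

text \<open>Factor \<open>f s = (s - s0) ^ m * g s\<close> with g nonzero near s0: m is the order of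
  the zero, and the contribution of g vanishes in the limit.\<close>

lemma logderiv_limit:
  fixes f :: "complex \<Rightarrow> complex"
  assumes f: "f holomorphic_on S" and S: "open S" "connected S" and s0: "s0 \<in> S" and nz: "\<exists>w\<in>S. f w \<noteq> 0"
  obtains m :: nat where "((\<lambda>s. (s - s0) * (deriv f s / f s)) \<longlongrightarrow> of_nat m) (at s0)"
    "m = 0 \<longleftrightarrow> f s0 \<noteq> 0" "\<forall>\<^sub>F s in at s0. f s \<noteq> 0"
proof (cases "f s0 = 0")
  case False
  have c: "isCont f s0" "isCont (deriv f) s0"
    using f S s0 holomorphic_deriv[OF f S(1)] holomorphic_on_imp_continuous_on continuous_on_eq_continuous_at by blast+
  have "((\<lambda>s. (s - s0) * (deriv f s / f s)) \<longlongrightarrow> (s0 - s0) * (deriv f s0 / f s0)) (at s0)"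
    using c False by (intro tendsto_intros) (auto simp: isCont_def)
  moreover have "\<forall>\<^sub>F s in at s0. f s \<noteq> 0"
    using tendsto_imp_eventually_ne[OF c(1)[unfolded isCont_def] False] .
  ultimately show ?thesis using that[of 0] False by auto
next
  case True
  then have "\<not> f constant_on S" using nz s0 unfolding constant_on_def by force
  from holomorphic_factor_zero_nonconstant[OF f S s0 True this]
  obtain g r n where n: "0 < n"  "0 < r"  "ball s0 r \<subseteq> S" "g holomorphic_on ball s0 r"
     and fac: "\<And>w. w \<in> ball s0 r \<Longrightarrow> f w = (w - s0)^n * g w"
     and g: "\<And>w. w \<in> ball s0 r \<Longrightarrow> g w \<noteq> 0" by metis
  have c: "isCont g s0" "isCont (deriv g) s0"
    using n holomorphic_deriv[OF n(4)] holomorphic_on_imp_continuous_on continuous_on_eq_continuous_at[of "ball s0 r"]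
    by (metis centre_in_ball open_ball)+
  have ev: "\<forall>\<^sub>F s in at s0. s \<in> ball s0 r \<and> s \<noteq> s0"
    using n(2) by (auto simp: eventually_at_filter intro: eventually_nhds_in_open[THEN eventually_mono, of "ball s0 r"])
  have fnz: "\<forall>\<^sub>F s in at s0. f s \<noteq> 0"
    using ev by eventually_elim (use fac g in auto)
  have "((\<lambda>s. of_nat n + (s - s0) * (deriv g s / g s)) \<longlongrightarrow> of_nat n + (s0 - s0) * (deriv g s0 / g s0)) (at s0)"
    using c g[of s0] n(2) by (intro tendsto_intros) (auto simp: isCont_def)
  moreover have "\<forall>\<^sub>F s in at s0. of_nat n + (s - s0) * (deriv g s / g s) = (s - s0) * (deriv f s / f s)"
    using ev
  proof eventually_elim
    case (elim s)
    have "(g has_field_derivative deriv g s) (at s)" using holomorphic_derivI[OF n(4)] elim by auto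
    then have "((\<lambda>w. (w - s0)^n * g w) has_field_derivative (of_nat n * (s - s0)^(n-1)) * g s + deriv g s * (s - s0)^n) (at s)"
      by (auto intro!: derivative_eq_intros)
    then have "(f has_field_derivative (of_nat n * (s - s0)^(n-1)) * g s + deriv g s * (s - s0)^n) (at s)"
      using has_field_derivative_transform_within_open[OF _ open_ball[of s0 r]] elim fac by auto
    then have d: "deriv f s = (of_nat n * (s - s0)^(n-1)) * g s + deriv g s * (s - s0)^n" by (rule DERIV_imp_deriv)
    have p: "(s - s0)^n = (s - s0) * (s - s0)^(n-1)" using n(1) by (simp add: power_eq_if)
    define v q where "v = s - s0" and "q = (s - s0)^(n-1)"
    have "v \<noteq> 0" "q \<noteq> 0" "g s \<noteq> 0" using elim g by (auto simp: v_def q_def)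
    moreover have "f s = v * q * g s" using fac[of s] elim p by (simp add: v_def q_def)
    moreover have "deriv f s = of_nat n * q * g s + deriv g s * (v * q)" using d p by (simp add: v_def q_def)
    ultimately show ?case unfolding v_def[symmetric] by (simp add: divide_simps) (simp add: algebra_simps)
  qed
  ultimately have "((\<lambda>s. (s - s0) * (deriv f s / f s)) \<longlongrightarrow> of_nat n) (at s0)"
    using tendsto_cong by force
  then show ?thesis using that[of n] n(1) True fnz by auto
qed

lemma pole_free_zeta_logderiv_limit:
  assumes "Re s0 > 0"
  obtains m :: nat where "((\<lambda>s. (s - s0) * (deriv pole_free_zeta s / pole_free_zeta s)) \<longlongrightarrow> of_nat m) (at s0)"
    "m = 0 \<longleftrightarrow> pole_free_zeta s0 \<noteq> 0" "\<forall>\<^sub>F s in at s0. pole_free_zeta s \<noteq> 0"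
proof -
  have conn: "connected {s. Re s > 0}"
    by (intro convex_connected convex_halfspace_Re_gt)
  have "\<exists>w\<in>{s. Re s > 0}. pole_free_zeta w \<noteq> 0" using pole_free_zeta_1 by (intro bexI[of _ 1]) auto
  from logderiv_limit[OF pole_free_zeta_holomorphic open_Re_gt conn _ this, of s0] assms show ?thesis using that by blast
qed

lemma mangoldt_series_eq_if_nonzero:
  assumes "Re s > 1" "pole_free_zeta s \<noteq> 0"
  shows "mangoldt_series s = 1 / (s - 1) - deriv pole_free_zeta s / pole_free_zeta s"
proof -
  have "s \<noteq> 1" using assms by auto
  then show ?thesis using pole_free_zeta_logderiv[OF assms(1)] assms(2) by (simp add: field_simps)
qed

text \<open>Near s0 the logarithmic derivative equals
  \<open>1 / (s - 1) - mangoldt_series s\<close>, which is continuous at s0; so the order of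
  vanishing there is 0.\<close>

lemma pole_free_zeta_nonzero_gt1:
  assumes "Re s0 > 1"
  shows "pole_free_zeta s0 \<noteq> 0"
proof -
  obtain m :: nat where m: "((\<lambda>s. (s - s0) * (deriv pole_free_zeta s / pole_free_zeta s)) \<longlongrightarrow> of_nat m) (at s0)"
    "m = 0 \<longleftrightarrow> pole_free_zeta s0 \<noteq> 0" "\<forall>\<^sub>F s in at s0. pole_free_zeta s \<noteq> 0" using pole_free_zeta_logderiv_limit[of s0] assms by auto
  have "isCont mangoldt_series s0"
    using mangoldt_series_holomorphic assms holomorphic_on_imp_continuous_on continuous_on_eq_continuous_at[OF open_Re_gt[of 1]] by blast
  moreover have "s0 \<noteq> 1" using assms by auto
  ultimately have "((\<lambda>s. (s - s0) * (1 / (s - 1) - mangoldt_series s)) \<longlongrightarrow> (s0 - s0) * (1 / (s0 - 1) - mangoldt_series s0)) (at s0)"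
    by (intro tendsto_intros) (auto simp: isCont_def)
  moreover have "\<forall>\<^sub>F s in at s0. s \<in> {s. Re s > 1}"
    using assms open_Re_gt[of 1] by (intro eventually_at_in_open') auto
  with m(3) have "\<forall>\<^sub>F s in at s0. (s - s0) * (1 / (s - 1) - mangoldt_series s) = (s - s0) * (deriv pole_free_zeta s / pole_free_zeta s)"
  proof eventually_elim
    case (elim s)
    then show ?case using mangoldt_series_eq_if_nonzero[of s] by simp
  qed
  ultimately have "((\<lambda>s. (s - s0) * (deriv pole_free_zeta s / pole_free_zeta s)) \<longlongrightarrow> 0) (at s0)"
    using tendsto_cong by force
  from tendsto_unique[OF _ this m(1)] have "m = 0" by auto
  with m show ?thesis by auto
qed

lemma mangoldt_series_eq: "Re s > 1 \<Longrightarrow> mangoldt_series s = 1 / (s - 1) - deriv pole_free_zeta s / pole_free_zeta s"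
  using mangoldt_series_eq_if_nonzero pole_free_zeta_nonzero_gt1 by simp

lemma Re_of_nat_powr:
  assumes "n > 0"
  shows "Re (of_nat n powr (- (of_real \<sigma> + \<i> * of_real t))) = real n powr (-\<sigma>) * cos (t * ln (real n))"
proof -
  have "(of_nat n powr (- (of_real \<sigma> + \<i> * of_real t)) :: complex) 
      = exp (of_real (- \<sigma> * ln (real n)) + \<i> * of_real (- t * ln (real n)))"
    using assms by (simp add: powr_def algebra_simps)
  also have "Re \<dots> = exp (- \<sigma> * ln (real n)) * cos (- t * ln (real n))" by (simp add: Re_exp)
  finally show ?thesis using assms by (simp add: powr_def)
qed

text \<open>Termwise with \<open>x = t * ln n\<close>: the weights
  \<open>mangoldt n * n powr (-\<sigma>)\<close> are nonnegative, and the trigonometric factor is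
  \<open>2 * (1 + cos x)^2\<close>.\<close>

lemma three_four_one:
  assumes "\<sigma> > 1"
  shows "3 * Re (mangoldt_series (of_real \<sigma>)) + 4 * Re (mangoldt_series (of_real \<sigma> + \<i> * of_real t)) + Re (mangoldt_series (of_real \<sigma> + \<i> * of_real (2 * t))) \<ge> 0"
proof -
  define g where "g = (\<lambda>u n. mangoldt n * (real n powr (-\<sigma>) * cos (u * ln (real n))))"
  have s: "g u sums Re (mangoldt_series (of_real \<sigma> + \<i> * of_real u))" for u
  proof -
    have "(\<lambda>n. Re (mangoldt n * of_nat n powr (-(of_real \<sigma> + \<i> * of_real u)))) sums Re (mangoldt_series (of_real \<sigma> + \<i> * of_real u))"
      using assms by (intro sums_Re mangoldt_series_sums) auto
    moreover have "Re (mangoldt n * of_nat n powr (-(of_real \<sigma> + \<i> * of_real u))) = g u n" for n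
    proof (cases "n = 0")
      case False
      then show ?thesis using Re_of_nat_powr[of n \<sigma> u] by (simp add: g_def del: minus_add_distrib)
    qed (simp add: g_def)
    ultimately show ?thesis by (simp del: times_complex.sel)
  qed
  have S: "(\<lambda>n. 3 * g 0 n + 4 * g t n + g (2*t) n) sums (3 * Re (mangoldt_series (of_real \<sigma> + \<i> * of_real 0)) 
    + 4 * Re (mangoldt_series (of_real \<sigma> + \<i> * of_real t)) + Re (mangoldt_series (of_real \<sigma> + \<i> * of_real (2 * t))))"
    by (intro sums_add sums_mult s)
  have N: "3 * g 0 n + 4 * g t n + g (2*t) n \<ge> 0" for n
  proof -
    have "3 + 4 * cos x + cos (2 * x) = 2 * (1 + cos x)^2" for x :: real
      unfolding cos_double_cos by (simp add: power2_eq_square algebra_simps)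
    note trig = this[of "t * ln (real n)"]
    define A where "A = mangoldt n * real n powr (-\<sigma>)"
    have g: "g u n = A * cos (u * ln (real n))" for u by (simp add: g_def A_def)
    have "3 * g 0 n + 4 * g t n + g (2*t) n = A * (3 + 4 * cos (t * ln (real n)) + cos (2 * (t * ln (real n))))"
      unfolding g by (simp add: distrib_left mult.assoc)
    then have "3 * g 0 n + 4 * g t n + g (2*t) n = A * (2 * (1 + cos (t * ln (real n)))^2)"
      unfolding trig .
    moreover have "A \<ge> 0" by (simp add: A_def mangoldt_nonneg)
    ultimately show ?thesis by simp
  qed
  from sums_le[OF N sums_zero S] show ?thesis by simp
qed

text \<open>Multiply the inequality \<open>three_four_one\<close> by \<open>x - 1\<close> and let x
  tend to 1 from the right. The three terms tend to 3, \<open>- 4 * m1\<close> and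
  \<open>- m2\<close>, where m1 and m2 are the orders of vanishing at 1 + it and 1 + 2it. As 3 < 4,
  m1 must be 0.\<close>

lemma pole_free_zeta_nonzero_ge1:
  assumes "Re s0 \<ge> 1"
  shows "pole_free_zeta s0 \<noteq> 0"
proof (cases "Re s0 > 1")
  case True then show ?thesis by (rule pole_free_zeta_nonzero_gt1)
next
  case False
  then have re: "Re s0 = 1" using assms by auto
  define t where "t = Im s0"
  have s0: "s0 = of_real 1 + \<i> * of_real t" using re by (simp add: t_def complex_eq_iff)
  show ?thesis
  proof (cases "t = 0")
    case True then show ?thesis using s0 pole_free_zeta_1 by simp
  next
    case t: False
    define P where "P = (\<lambda>u. of_real 1 + \<i> * of_real u :: complex)"
    \<comment> \<open>\<open>1 / (s - 1)\<close> contributes 1 if u = 0 and nothing otherwise; the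
      logarithmic derivative contributes minus the order of the zero.\<close>
    have lim: "\<exists>m::nat. ((\<lambda>x. of_real (x - 1) * mangoldt_series (of_real x + \<i> * of_real u)) \<longlongrightarrow> (if u = 0 then 1 else 0) - of_nat m) (at_right 1)
        \<and> (m = 0 \<longleftrightarrow> pole_free_zeta (P u) \<noteq> 0)" for u
    proof -
      obtain m :: nat where m: "((\<lambda>s. (s - P u) * (deriv pole_free_zeta s / pole_free_zeta s)) \<longlongrightarrow> of_nat m) (at (P u))"
        "m = 0 \<longleftrightarrow> pole_free_zeta (P u) \<noteq> 0" using pole_free_zeta_logderiv_limit[of "P u"] by (auto simp: P_def)
      have "filterlim (\<lambda>x::real. of_real x + \<i> * of_real u) (at (P u)) (at_right 1)"
        by (rule filterlim_atI) (auto simp: P_def eventually_at_filter intro!: tendsto_eq_intros)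
      from filterlim_compose[OF m(1) this]
      have 1: "((\<lambda>x. of_real (x - 1) * (deriv pole_free_zeta (of_real x + \<i> * of_real u) / pole_free_zeta (of_real x + \<i> * of_real u))) \<longlongrightarrow> of_nat m) (at_right 1)"
        by (simp add: P_def)
      have 2: "((\<lambda>x. of_real (x - 1) * (1 / (of_real x + \<i> * of_real u - 1))) \<longlongrightarrow> (if u = 0 then 1 else 0 :: complex)) (at_right (1::real))"
      proof (cases "u = 0")
        case True
        have "\<forall>\<^sub>F x in at_right (1::real). (1::complex) = of_real (x - 1) * (1 / (of_real x + \<i> * of_real u - 1))"
          unfolding eventually_at_filter using True by (auto simp: field_simps)
        from tendsto_cong[THEN iffD1, OF this tendsto_const] show ?thesis using True by simp
      next
        case False
        have "((\<lambda>x. of_real (x - 1) * (1 / (of_real x + \<i> * of_real u - 1))) \<longlongrightarrow> of_real (1 - 1) * (1 / (of_real 1 + \<i> * of_real u - 1))) (at_right (1::real))"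
          using False by (intro tendsto_intros) auto
        then show ?thesis using False by simp
      qed
      have "\<forall>\<^sub>F x in at_right (1::real). x > 1" by (simp add: eventually_at_right_less)
      then have "\<forall>\<^sub>F x in at_right (1::real). of_real (x - 1) * (1 / (of_real x + \<i> * of_real u - 1)) - 
           of_real (x - 1) * (deriv pole_free_zeta (of_real x + \<i> * of_real u) / pole_free_zeta (of_real x + \<i> * of_real u)) 
           = of_real (x - 1) * mangoldt_series (of_real x + \<i> * of_real u)"
        by eventually_elim (subst mangoldt_series_eq, auto simp: algebra_simps)
      from tendsto_cong[THEN iffD1, OF this tendsto_diff[OF 2 1]] m(2) show ?thesis by blast
    qed
    obtain m0 m1 m2 :: nat where
      m0: "((\<lambda>x. of_real (x - 1) * mangoldt_series (of_real x + \<i> * of_real 0)) \<longlongrightarrow> 1 - of_nat m0) (at_right 1)" "m0 = 0 \<longleftrightarrow> pole_free_zeta (P 0) \<noteq> 0"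
      and m1: "((\<lambda>x. of_real (x - 1) * mangoldt_series (of_real x + \<i> * of_real t)) \<longlongrightarrow> 0 - of_nat m1) (at_right 1)" "m1 = 0 \<longleftrightarrow> pole_free_zeta (P t) \<noteq> 0"
      and m2: "((\<lambda>x. of_real (x - 1) * mangoldt_series (of_real x + \<i> * of_real (2 * t))) \<longlongrightarrow> 0 - of_nat m2) (at_right 1)"
      using lim[of 0] lim[of t] lim[of "2 * t"] t by auto
    have "((\<lambda>x. 3 * Re (of_real (x - 1) * mangoldt_series (of_real x + \<i> * of_real 0)) + 4 * Re (of_real (x - 1) * mangoldt_series (of_real x + \<i> * of_real t))
       + Re (of_real (x - 1) * mangoldt_series (of_real x + \<i> * of_real (2 * t)))) \<longlongrightarrow> 3 * Re (1 - of_nat m0) + 4 * Re (0 - of_nat m1) + Re (0 - of_nat m2)) (at_right 1)"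
      by (intro tendsto_intros m0 m1 m2)
    moreover have "\<forall>\<^sub>F x in at_right (1::real). x > 1" by (simp add: eventually_at_right_less)
    then have "\<forall>\<^sub>F x in at_right 1. 3 * Re (of_real (x - 1) * mangoldt_series (of_real x + \<i> * of_real 0)) + 4 * Re (of_real (x - 1) * mangoldt_series (of_real x + \<i> * of_real t))
       + Re (of_real (x - 1) * mangoldt_series (of_real x + \<i> * of_real (2 * t))) \<ge> 0"
    proof eventually_elim
      case (elim x)
      have "0 \<le> (x - 1) * (3 * Re (mangoldt_series (of_real x)) + 4 * Re (mangoldt_series (of_real x + \<i> * of_real t)) + Re (mangoldt_series (of_real x + \<i> * of_real (2 * t))))"
        using elim three_four_one[of x t] by (intro mult_nonneg_nonneg) auto
      also have "\<dots> = 3 * Re (of_real (x - 1) * mangoldt_series (of_real x + \<i> * of_real 0)) + 4 * Re (of_real (x - 1) * mangoldt_series (of_real x + \<i> * of_real t))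
       + Re (of_real (x - 1) * mangoldt_series (of_real x + \<i> * of_real (2 * t)))"
      proof -
        have "Re (of_real r * w) = r * Re w" for r w by simp
        then show ?thesis by (simp only: of_real_0 mult_zero_right add_0_right) (simp add: distrib_left)
      qed
      finally show ?case .
    qed
    ultimately have "3 * Re (1 - of_nat m0) + 4 * Re (0 - of_nat m1) + Re (0 - of_nat m2) \<ge> 0"
      by (intro tendsto_lowerbound) auto
    then have "m1 = 0" using m0(2) by (auto simp: P_def)
    then show ?thesis using m1(2) s0 by (simp add: P_def)
  qed
qed

section \<open>Newman's Tauberian theorem\<close>

lemma powr_diff_mvt:
  assumes "0 < a" "a < (b::real)"
  obtains \<xi> where "a < \<xi>" "\<xi> < b" "b powr x - a powr x = (b - a) * (x * \<xi> powr (x - 1))"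
proof -
  have "\<exists>z. a < z \<and> z < b \<and> b powr x - a powr x = (b - a) * (x * z powr (x - 1))"
    using assms by (intro MVT2) (auto intro!: derivative_eq_intros)
  then show ?thesis using that by blast
qed

text \<open>Comparison with an integral through the mean value theorem. The induction carries the
  subtracted term \<open>(N + k) powr (-x)\<close>, without which it would not close.\<close>

lemma sum_powr_tail_le:
  assumes "x > 0" "N > 0"
  shows "(\<Sum>n\<in>{N<..N+k}. real n powr (-x - 1)) \<le> real N powr (-x) / x"
proof -
  have "(\<Sum>n\<in>{N<..N+k}. real n powr (-x - 1)) \<le> (real N powr (-x) - real (N+k) powr (-x)) / x"
  proof (induction k)
    case (Suc k)
    obtain \<xi> where xi: "real (N+k) < \<xi>" "\<xi> < real (Suc (N+k))"
      "real (Suc (N+k)) powr (-x) - real (N+k) powr (-x) = (real (Suc (N+k)) - real (N+k)) * (-x * \<xi> powr (-x - 1))"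
      using powr_diff_mvt[of "real (N+k)" "real (Suc (N+k))" "-x"] assms by auto
    have "\<xi> > 0" using xi assms by linarith
    then have "real (Suc (N+k)) powr (-x-1) \<le> \<xi> powr (-x - 1)" 
      using xi assms powr_mono2'[of "-x-1" \<xi> "real (Suc (N+k))"] by simp
    also have "\<xi> powr (-x-1) = (real (N+k) powr (-x) - real (Suc (N+k)) powr (-x)) / x"
      using xi(3) assms by (simp add: field_simps)
    finally have "real (Suc (N+k)) powr (-x-1) \<le> (real (N+k) powr (-x) - real (Suc (N+k)) powr (-x)) / x" .
    moreover have "{N<..N+Suc k} = insert (Suc (N+k)) {N<..N+k}" by auto
    ultimately show ?case using Suc by (simp add: diff_divide_distrib)
  qed auto
  also have "\<dots> \<le> real N powr (-x) / x" using assms by (simp add: divide_right_mono)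
  finally show ?thesis .
qed

text \<open>The summands decrease for \<open>x \<le> 1\<close> and increase for larger x. In the
  second case the comparison with the integral needs the last summand as an extra term; the
  conclusion allows for it in both.\<close>

lemma sum_powr_le:
  assumes "x > 0"
  shows "(\<Sum>n=1..Suc k. real n powr (x - 1)) \<le> real (Suc k) powr x * (1 / x + 1 / real (Suc k))"
proof -
  have "(\<Sum>n=1..Suc k. real n powr (x - 1)) \<le> real (Suc k) powr x / x + (if x \<le> 1 then 0 else real (Suc k) powr (x - 1))"
  proof (induction k)
    case 0 then show ?case using assms by (auto simp: field_simps)
  next
    case (Suc k)
    obtain \<xi> where xi: "real (Suc k) < \<xi>" "\<xi> < real (Suc (Suc k))"
      "real (Suc (Suc k)) powr x - real (Suc k) powr x = (real (Suc (Suc k)) - real (Suc k)) * (x * \<xi> powr (x - 1))"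
      using powr_diff_mvt[of "real (Suc k)" "real (Suc (Suc k))" x] by auto
    have eq: "\<xi> powr (x-1) = (real (Suc (Suc k)) powr x - real (Suc k) powr x) / x"
      using xi(3) assms by (simp add: field_simps)
    have pos: "\<xi> > 0" using xi by linarith
    have sumS: "(\<Sum>n=1..Suc (Suc k). real n powr (x - 1)) = (\<Sum>n=1..Suc k. real n powr (x - 1)) + real (Suc (Suc k)) powr (x - 1)"
      by simp
    show ?case
    proof (cases "x \<le> 1")
      case True
      then have "real (Suc (Suc k)) powr (x-1) \<le> \<xi> powr (x - 1)" using xi pos by (intro powr_mono2') auto
      then show ?thesis using Suc True eq unfolding sumS by (simp add: diff_divide_distrib)
    next
      case False
      then have "real (Suc k) powr (x-1) \<le> \<xi> powr (x - 1)" using xi pos by (intro powr_mono2) auto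
      then show ?thesis using Suc False eq unfolding sumS by (simp add: diff_divide_distrib)
    qed
  qed
  also have "\<dots> \<le> real (Suc k) powr x / x + real (Suc k) powr (x - 1)" by simp
  also have "\<dots> = real (Suc k) powr x * (1 / x + 1 / real (Suc k))"
    by (simp add: powr_diff field_simps)
  finally show ?thesis .
qed

text \<open>With the primitive Ln on the plane slit along the negative axis, only the end points
  matter; the mirror lemma uses \<open>Ln (-z)\<close> on the left. Two halves add up to
  \<open>2 * pi * \<i>\<close>, so a closed contour is seen to wind once about 0 without any
  geometry.\<close>

lemma contour_integral_inverse_right:
  assumes "R > 0" "valid_path \<gamma>" "path_image \<gamma> \<subseteq> - \<real>\<^sub>\<le>\<^sub>0" "pathstart \<gamma> = - \<i> * of_real R" "pathfinish \<gamma> = \<i> * of_real R"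
  shows "((\<lambda>z. 1 / z) has_contour_integral \<i> * pi) \<gamma>"
proof -
  have "((\<lambda>z. 1 / z) has_contour_integral (Ln (pathfinish \<gamma>) - Ln (pathstart \<gamma>))) \<gamma>"
    by (rule contour_integral_primitive[OF _ assms(2,3)]) (auto intro!: derivative_eq_intros simp: field_simps)
  moreover have "Ln (\<i> * of_real R) = Ln (of_real R) + \<i> * (pi/2)" "Ln (- \<i> * of_real R) = Ln (of_real R) - \<i> * (pi/2)"
    using assms(1) Ln_times_of_real[of R \<i>] Ln_times_of_real[of R "-\<i>"] by (simp_all add: mult.commute Ln_of_real)
  ultimately show ?thesis unfolding assms(4,5) by simp
qed

lemma contour_integral_inverse_left:
  assumes "R > 0" "valid_path \<gamma>" "path_image \<gamma> \<subseteq> - \<real>\<^sub>\<ge>\<^sub>0" "pathstart \<gamma> = \<i> * of_real R" "pathfinish \<gamma> = - \<i> * of_real R"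
  shows "((\<lambda>z. 1 / z) has_contour_integral \<i> * pi) \<gamma>"
proof -
  have "((\<lambda>z. 1 / z) has_contour_integral (Ln (- pathfinish \<gamma>) - Ln (- pathstart \<gamma>))) \<gamma>"
    by (rule contour_integral_primitive[OF _ assms(2,3), where f = "\<lambda>z. Ln (-z)"]) (auto intro!: derivative_eq_intros simp: field_simps)
  moreover have "Ln (\<i> * of_real R) = Ln (of_real R) + \<i> * (pi/2)" "Ln (- (\<i> * of_real R)) = Ln (of_real R) - \<i> * (pi/2)"
    using assms(1) Ln_times_of_real[of R \<i>] Ln_times_of_real[of R "-\<i>"] by (simp_all add: mult.commute Ln_of_real)
  ultimately show ?thesis unfolding assms(4,5) by (simp add: field_simps)
qed

text \<open>Newman's kernel \<open>1 / z + z / R\<^sup>2\<close> has the same residue as \<open>1 / z\<close>, but is small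
  near the points \<open>\<plusminus> \<i> R\<close> of the circle of radius \<open>R\<close>.\<close>
lemma Cauchy_newman_kernel:
  assumes "convex D" "open D" "0 \<in> D" "g holomorphic_on D"
    and "valid_path \<gamma>" "path_image \<gamma> \<subseteq> D - {0}" "pathfinish \<gamma> = pathstart \<gamma>"
    and I: "((\<lambda>z. 1 / z) has_contour_integral 2 * of_real pi * \<i>) \<gamma>"
  shows "((\<lambda>z. g z * (1 / z + z / of_real R ^ 2)) has_contour_integral 2 * of_real pi * \<i> * g 0) \<gamma>"
proof -
  have "winding_number \<gamma> 0 = 1 / (2 * pi * \<i>) * contour_integral \<gamma> (\<lambda>w. 1 / (w - 0))"
    using assms(5,6) by (intro winding_number_valid_path) auto
  also have "\<dots> = 1" using contour_integral_unique[OF I] by simp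
  finally have w: "winding_number \<gamma> 0 = 1" .
  \<comment> \<open>The kernel is \<open>(1 + z^2 / R^2) / z\<close>. Its numerator is 1 at 0, so
    Cauchy's formula applied to f returns \<open>g 0\<close>.\<close>
  define f where "f = (\<lambda>z. g z * (1 + z^2 / of_real R ^ 2))"
  have "f holomorphic_on D" unfolding f_def by (cases "R = 0") (auto intro!: holomorphic_intros assms)
  from Cauchy_integral_formula_convex_simple[OF assms(1) this _ assms(5-7)] w
  have "((\<lambda>w. f w / (w - 0)) has_contour_integral (2*pi * \<i> * 1 * f 0)) \<gamma>" using assms(2,3) by (auto simp: interior_open)
  then have "((\<lambda>w. f w / w) has_contour_integral (2 * of_real pi * \<i> * g 0)) \<gamma>" by (simp add: f_def)
  then show ?thesis
  proof (rule has_contour_integral_eq)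
    fix z assume "z \<in> path_image \<gamma>"
    then have z: "z \<noteq> 0" using assms(6) by auto
    have "f z / z = g z * ((1 + z^2 / of_real R ^ 2) / z)" by (simp add: f_def)
    also have "(1 + z^2 / of_real R ^ 2) / z = 1 / z + z / of_real R ^ 2"
      using z by (simp add: add_divide_distrib power2_eq_square)
    finally show "f z / z = g z * (1 / z + z / of_real R ^ 2)" .
  qed
qed

text \<open>On the circle \<open>1 / z\<close> is \<open>cnj z / R^2\<close>, so the kernel is real
  and proportional to \<open>Re z\<close>: the factor that cancels \<open>1 / x\<close> in the
  bounds for tails and partial sums.\<close>

lemma newman_kernel_circle:
  assumes "norm z = R" "R > 0"
  shows "1 / z + z / of_real R ^ 2 = of_real (2 * Re z / R^2)"
proof -
  have "1 / z = cnj z / of_real R ^ 2" using assms complex_div_cnj[of 1 z] by simp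
  then have "1 / z + z / of_real R ^ 2 = (z + cnj z) / of_real R ^ 2" by (simp add: add_divide_distrib)
  then show ?thesis by (simp add: complex_add_cnj)
qed

lemma right_arc:
  assumes "R > 0" "z \<in> path_image (part_circlepath 0 R (-pi/2) (pi/2))"
  shows "norm z = R" "Re z \<ge> 0"
proof -
  obtain x where x: "z = of_real R * exp (\<i> * of_real x)" "-pi/2 \<le> x" "x \<le> pi/2"
    using assms(2) by (subst (asm) path_image_part_circlepath) auto
  show "norm z = R" using x assms by (simp add: norm_mult)
  have "Re z = R * cos x" using x by (simp add: Re_exp)
  then show "Re z \<ge> 0" using cos_ge_zero[of x] x assms by simp
qed

lemma left_arc:
  assumes "R > 0" "z \<in> path_image (part_circlepath 0 R (pi/2) (3*pi/2))"
  shows "norm z = R" "Re z \<le> 0"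
proof -
  obtain x where x: "z = of_real R * exp (\<i> * of_real x)" "pi/2 \<le> x" "x \<le> 3*pi/2"
    using assms(2) by (subst (asm) path_image_part_circlepath) auto
  show "norm z = R" using x assms by (simp add: norm_mult)
  have "Re z = - (R * cos (x - pi))" using x by (simp add: Re_exp cos_diff)
  moreover have "R * cos (x - pi) \<ge> 0" using x assms by (intro mult_nonneg_nonneg cos_ge_zero) auto
  ultimately show "Re z \<le> 0" by linarith
qed

lemma arc_ends:
  "pathstart (part_circlepath 0 R (-pi/2) (pi/2)) = - \<i> * of_real R" 
  "pathfinish (part_circlepath 0 R (-pi/2) (pi/2)) = \<i> * of_real R"
  "pathstart (part_circlepath 0 R (pi/2) (3*pi/2)) = \<i> * of_real R" 
  "pathfinish (part_circlepath 0 R (pi/2) (3*pi/2)) = - \<i> * of_real R"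
proof -
  have e: "exp (\<i> * of_real x) = cis x" for x by (simp add: cis_conv_exp)
  have 3: "3 * pi / 2 = pi/2 + pi" by simp
  have "cis (3 * pi / 2) = - \<i>" unfolding 3 cis_mult[symmetric] by simp
  moreover have "cis (- pi / 2) = - \<i>" by (simp add: complex_eq_iff)
  ultimately show 
  "pathstart (part_circlepath 0 R (-pi/2) (pi/2)) = - \<i> * of_real R" 
  "pathfinish (part_circlepath 0 R (-pi/2) (pi/2)) = \<i> * of_real R"
  "pathstart (part_circlepath 0 R (pi/2) (3*pi/2)) = \<i> * of_real R" 
  "pathfinish (part_circlepath 0 R (pi/2) (3*pi/2)) = - \<i> * of_real R"
    unfolding pathstart_part_circlepath pathfinish_part_circlepath e by (simp_all add: mult.commute)
qed

text \<open>F and the partial sum S share the right half circle A, where their difference is a tail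
  of the series. On the left they part: S is entire and stays on the half circle L, while F is moved
  to three sides B of a thin rectangle, which keeps it in the domain of F. A and L contribute
  \<open>C / R\<close> each, L also \<open>C / N\<close>, and B goes into
  \<open>\<epsilon>\<close>.\<close>

lemma newman_estimate:
  fixes a :: "nat \<Rightarrow> complex"
  assumes C: "\<And>n. norm (a n) \<le> C" and U: "open U" "{s. Re s \<ge> 1} \<subseteq> U" and F: "F holomorphic_on U"
    and sums: "\<And>s. Re s > 1 \<Longrightarrow> (\<lambda>n. a n * of_nat n powr (-s)) sums F s"
    and R: "R > 0" and \<epsilon>: "\<epsilon> > 0"
  shows "\<forall>\<^sub>F N in sequentially. norm (F 1 - (\<Sum>n\<le>N. a n * of_nat n powr (-1))) \<le> 2 * C / R + C / real N + \<epsilon>"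
proof -
  define S where "S = (\<lambda>N s. \<Sum>n\<le>N. a n * of_nat n powr (-s))"
  define H where "H = (\<lambda>z. F (1 + z))"
  define K where "K = (\<lambda>z::complex. 1 / z + z / of_real R ^ 2)"
  have C0: "C \<ge> 0" using order_trans[OF norm_ge_zero C[of 0]] .
  \<comment> \<open>A whole e-neighbourhood of the segment from 1 - (R+1)i to 1 + (R+1)i lies in U.
    The margin 1 keeps the horizontal sides, at height R, inside the open set D.\<close>
  have "compact ((\<lambda>y. 1 + \<i> * of_real y :: complex) ` {-(R+1)..R+1})"
    by (intro compact_continuous_image continuous_intros) auto
  moreover have "(\<lambda>y. 1 + \<i> * of_real y :: complex) ` {-(R+1)..R+1} \<subseteq> U" using U(2) by auto
  ultimately obtain e where e: "e > 0" "(\<Union>x\<in>(\<lambda>y. 1 + \<i> * of_real y) ` {-(R+1)..R+1}. ball x e) \<subseteq> U"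
    using compact_subset_open_imp_ball_epsilon_subset[OF _ U(1)] by metis
  define D where "D = {z. Re z > - e \<and> Im z < R + 1 \<and> Im z > - (R + 1)}"
  have D_eq: "D = {z. Re z > - e} \<inter> {z. Im z < R + 1} \<inter> {z. Im z > - (R + 1)}" by (auto simp: D_def)
  have D: "convex D" "open D" "0 \<in> D"
    unfolding D_eq using e R
    by (auto intro!: convex_Int convex_halfspace_Re_gt convex_halfspace_Im_lt convex_halfspace_Im_gt open_Int
        open_halfspace_Re_gt open_halfspace_Im_lt open_halfspace_Im_gt)
  have DU: "1 + z \<in> U" if "z \<in> D" for z
  proof (cases "Re z \<ge> 0")
    case True then show ?thesis using U(2) by auto
  next
    case False
    have "1 + z - (1 + \<i> * of_real (Im z)) = of_real (Re z)" by (simp add: complex_eq_iff)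
    then have "dist (1 + \<i> * of_real (Im z)) (1 + z) = \<bar>Re z\<bar>" by (metis dist_commute dist_norm norm_of_real)
    then have "1 + z \<in> ball (1 + \<i> * of_real (Im z)) e" using False that by (simp add: D_def)
    moreover have "1 + \<i> * of_real (Im z) \<in> (\<lambda>y. 1 + \<i> * of_real y) ` {-(R+1)..R+1}"
      using that by (intro image_eqI[of _ _ "Im z"]) (auto simp: D_def)
    ultimately show ?thesis using e(2) by blast
  qed
  have "(\<lambda>z. 1 + z) holomorphic_on D" by (intro holomorphic_intros)
  then have "(F \<circ> (\<lambda>z. 1 + z)) holomorphic_on D"
    by (rule holomorphic_on_compose_gen[OF _ F]) (use DU in auto)
  then have H: "H holomorphic_on D" by (simp add: H_def[abs_def] o_def)
  \<comment> \<open>The box Q is fixed before \<open>\<eta>\<close>, so that the bound M does not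
    depend on \<open>\<eta>\<close>.\<close>
  define Q where "Q = cbox (Complex (-(e/2)) (-R)) (Complex 0 R)"
  have QD: "Q \<subseteq> D" using e R by (auto simp: Q_def D_def in_cbox_complex_iff)
  have "compact (H ` Q)" unfolding Q_def[symmetric]
    using holomorphic_on_imp_continuous_on[OF H] QD by (intro compact_continuous_image) (auto simp: Q_def intro: continuous_on_subset)
  then obtain M where M: "M > 0" "\<And>z. z \<in> Q \<Longrightarrow> norm (H z) \<le> M"
    using compact_imp_bounded[THEN bounded_pos[THEN iffD1]] by (metis imageI)
  \<comment> \<open>\<open>e / 2\<close> keeps the rectangle in Q, R gives
    \<open>norm z \<le> 2 * R\<close> on it, and the last bound makes its two horizontal sides,
    \<open>3 * M * \<eta> / R\<close> each, cost at most \<open>\<epsilon>\<close>.\<close>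
  define \<eta> where "\<eta> = Min {e/2, R, \<epsilon> * R / (6 * M)}"
  have \<eta>: "\<eta> > 0" "\<eta> \<le> e/2" "\<eta> \<le> R" "\<eta> \<le> \<epsilon> * R / (6 * M)" using e R \<epsilon> M by (auto simp: \<eta>_def)
  define A where "A = part_circlepath 0 R (-pi/2) (pi/2)"
  define L where "L = part_circlepath 0 R (pi/2) (3*pi/2)"
  define p1 p2 p3 p4 where "p1 = Complex 0 R" and "p2 = Complex (-\<eta>) R" and "p3 = Complex (-\<eta>) (-R)" and "p4 = Complex 0 (-R)"
  define B where "B = linepath p1 p2 +++ linepath p2 p3 +++ linepath p3 p4"
  have p14: "p1 = \<i> * of_real R" "p4 = - \<i> * of_real R" by (simp_all add: p1_def p4_def complex_eq_iff)
  have ends: "pathstart A = p4" "pathfinish A = p1" "pathstart L = p1" "pathfinish L = p4"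
    unfolding A_def L_def arc_ends p14 by simp_all
  have valid [simp]: "valid_path A" "valid_path L" "valid_path B"
    by (simp_all add: A_def L_def B_def)
  have seg12: "z \<in> closed_segment p1 p2 \<Longrightarrow> Im z = R \<and> -\<eta> \<le> Re z \<and> Re z \<le> 0" for z
  proof -
    assume "z \<in> closed_segment p1 p2"
    then obtain u where u: "0 \<le> u" "u \<le> 1" "z = (1 - u) *\<^sub>R p1 + u *\<^sub>R p2" by (auto simp: closed_segment_def)
    have "Im z = R" "Re z = - (\<eta> * u)" unfolding u(3) p1_def p2_def by (simp_all add: algebra_simps)
    moreover have "0 \<le> \<eta> * u" "\<eta> * u \<le> \<eta> * 1" using u \<eta> by (auto intro!: mult_left_mono)
    ultimately show ?thesis by simp
  qed
  have seg23: "z \<in> closed_segment p2 p3 \<Longrightarrow> Re z = - \<eta> \<and> \<bar>Im z\<bar> \<le> R" for z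
  proof -
    assume "z \<in> closed_segment p2 p3"
    then obtain u where u: "0 \<le> u" "u \<le> 1" "z = (1 - u) *\<^sub>R p2 + u *\<^sub>R p3" by (auto simp: closed_segment_def)
    have "Im z = R * (1 - 2 * u)" "Re z = -\<eta>" unfolding u(3) p2_def p3_def by (simp_all add: algebra_simps)
    moreover have "\<bar>R * (1 - 2 * u)\<bar> \<le> R * 1" unfolding abs_mult using u R by (intro mult_mono) auto
    ultimately show ?thesis by simp
  qed
  have seg34: "z \<in> closed_segment p3 p4 \<Longrightarrow> Im z = -R \<and> -\<eta> \<le> Re z \<and> Re z \<le> 0" for z
  proof -
    assume "z \<in> closed_segment p3 p4"
    then obtain u where u: "0 \<le> u" "u \<le> 1" "z = (1 - u) *\<^sub>R p3 + u *\<^sub>R p4" by (auto simp: closed_segment_def)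
    have "Im z = - R" "Re z = - (\<eta> * (1 - u))" unfolding u(3) p3_def p4_def by (simp_all add: algebra_simps)
    moreover have "0 \<le> \<eta> * (1 - u)" "\<eta> * (1 - u) \<le> \<eta> * 1" using u \<eta> by (auto intro!: mult_left_mono)
    ultimately show ?thesis by simp
  qed
  have segQ: "z \<in> Q" if "z \<in> closed_segment p1 p2 \<union> closed_segment p2 p3 \<union> closed_segment p3 p4" for z
    using that seg12[of z] seg23[of z] seg34[of z] \<eta> R by (auto simp: Q_def in_cbox_complex_iff)
  have imB: "path_image B = closed_segment p1 p2 \<union> closed_segment p2 p3 \<union> closed_segment p3 p4"
    by (auto simp: B_def path_image_join)
  have seg_nz: "z \<notin> \<real>\<^sub>\<ge>\<^sub>0" if "z \<in> path_image B" for z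
    using that seg12[of z] seg23[of z] seg34[of z] \<eta> R unfolding imB by (auto simp: complex_nonneg_Reals_iff)
  have A: "norm z = R" "Re z \<ge> 0" if "z \<in> path_image A" for z using right_arc[OF R] that unfolding A_def by auto
  have L: "norm z = R" "Re z \<le> 0" if "z \<in> path_image L" for z using left_arc[OF R] that unfolding L_def by auto
  have A_nz: "z \<notin> \<real>\<^sub>\<le>\<^sub>0" if "z \<in> path_image A" for z
    using A[OF that] R by (auto simp: complex_nonpos_Reals_iff cmod_def)
  have L_nz: "z \<notin> \<real>\<^sub>\<ge>\<^sub>0" if "z \<in> path_image L" for z
    using L[OF that] R by (auto simp: complex_nonneg_Reals_iff cmod_def)
  have IA: "((\<lambda>z. 1 / z) has_contour_integral \<i> * pi) A"
    using A_nz ends p14 by (intro contour_integral_inverse_right[OF R]) auto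
  have IL: "((\<lambda>z. 1 / z) has_contour_integral \<i> * pi) L"
    using L_nz ends p14 by (intro contour_integral_inverse_left[OF R]) auto
  have endB: "pathstart B = p1" "pathfinish B = p4" by (simp_all add: B_def)
  have IB: "((\<lambda>z. 1 / z) has_contour_integral \<i> * pi) B"
    using seg_nz endB p14 by (intro contour_integral_inverse_left[OF R]) auto
  have IAB: "((\<lambda>z. 1 / z) has_contour_integral 2 * of_real pi * \<i>) (A +++ B)"
    using has_contour_integral_join[OF IA IB] by (simp add: algebra_simps)
  have IAL: "((\<lambda>z. 1 / z) has_contour_integral 2 * of_real pi * \<i>) (A +++ L)"
    using has_contour_integral_join[OF IA IL] by (simp add: algebra_simps)
  have AD: "path_image A \<subseteq> D - {0}"
  proof
    fix z assume z: "z \<in> path_image A"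
    then show "z \<in> D - {0}" using A[OF z] abs_Im_le_cmod[of z] e R by (auto simp: D_def)
  qed
  have BD: "path_image B \<subseteq> D - {0}" using segQ QD seg_nz unfolding imB by fastforce
  have LD: "path_image L \<subseteq> UNIV - {0}" using L R by force
  have K_circ: "K z = of_real (2 * Re z / R^2)" if "norm z = R" for z
    unfolding K_def using newman_kernel_circle[OF that R] .
  have S_hol: "(\<lambda>z. S N (1 + z)) holomorphic_on X" for N X unfolding S_def by (intro holomorphic_intros)
  have K_cont: "continuous_on X K" if "0 \<notin> X" for X
    unfolding K_def using R that by (intro continuous_intros) auto
  \<comment> \<open>The last fraction holds the horizontal sides and the vertical side of B. For
    fixed \<open>\<eta>\<close> the vertical side carries \<open>N powr (-\<eta>)\<close>, which
    tends to 0.\<close>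
  have main: "norm (F 1 - S N 1) \<le> 2 * C / R + C / real N + (6 * M * \<eta> / R + 2 * R * (M * real N powr (-\<eta>) * (1 / \<eta> + 2 / R))) / (2 * pi)"
    if N: "N > 0" for N
  proof -
    define f where "f = (\<lambda>z. (H z * of_nat N powr z) * K z)"
    define g where "g = (\<lambda>z. (S N (1 + z) * of_nat N powr z) * K z)"
    have hf: "(\<lambda>z. H z * of_nat N powr z) holomorphic_on D" by (intro holomorphic_intros H)
    have hg: "(\<lambda>z. S N (1 + z) * of_nat N powr z) holomorphic_on UNIV" by (intro holomorphic_intros S_hol)
    have "(f has_contour_integral 2 * of_real pi * \<i> * (H 0 * of_nat N powr 0)) (A +++ B)"
      unfolding f_def K_def
      by (rule Cauchy_newman_kernel[OF D hf _ _ _ IAB])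
         (use AD BD ends endB in \<open>auto simp: path_image_join\<close>)
    then have f_int: "(f has_contour_integral 2 * of_real pi * \<i> * F 1) (A +++ B)" using N by (simp add: H_def)
    have "(g has_contour_integral 2 * of_real pi * \<i> * (S N (1 + 0) * of_nat N powr 0)) (A +++ L)"
      unfolding g_def K_def
      by (rule Cauchy_newman_kernel[OF _ _ _ hg _ _ _ IAL])
         (use AD LD ends in \<open>auto simp: path_image_join\<close>)
    then have g_int: "(g has_contour_integral 2 * of_real pi * \<i> * S N 1) (A +++ L)" using N by simp
    have cf: "continuous_on (D - {0}) f" unfolding f_def
      by (intro continuous_intros K_cont holomorphic_on_imp_continuous_on holomorphic_on_subset[OF hf]) auto
    have cg: "continuous_on (UNIV - {0}) g" unfolding g_def
      by (intro continuous_intros K_cont holomorphic_on_imp_continuous_on holomorphic_on_subset[OF hg]) auto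
    have fA: "f contour_integrable_on A" and gA: "g contour_integrable_on A" and gL: "g contour_integrable_on L"
      unfolding A_def L_def using AD LD 
      by (auto intro!: contour_integrable_continuous_part_circlepath continuous_on_subset[OF cf] continuous_on_subset[OF cg] simp: A_def L_def)
    have f12: "f contour_integrable_on linepath p1 p2" and f23: "f contour_integrable_on linepath p2 p3"
      and f34: "f contour_integrable_on linepath p3 p4"
      using BD unfolding imB by (auto intro!: contour_integrable_continuous_linepath continuous_on_subset[OF cf])
    have fB: "f contour_integrable_on B" unfolding B_def using f12 f23 f34 by (simp)
    have "contour_integral (A +++ B) f = contour_integral A f + contour_integral B f"
      using fA fB ends endB by (intro contour_integral_join) auto
    also have "contour_integral B f = contour_integral (linepath p1 p2) f + contour_integral (linepath p2 p3) f + contour_integral (linepath p3 p4) f"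
      unfolding B_def using f12 f23 f34 by (simp)
    finally have 1: "2 * of_real pi * \<i> * F 1 = contour_integral A f + (contour_integral (linepath p1 p2) f + contour_integral (linepath p2 p3) f + contour_integral (linepath p3 p4) f)"
      using contour_integral_unique[OF f_int] by simp
    have "contour_integral (A +++ L) g = contour_integral A g + contour_integral L g"
      using gA gL ends by (intro contour_integral_join) auto
    then have 2: "2 * of_real pi * \<i> * S N 1 = contour_integral A g + contour_integral L g"
      using contour_integral_unique[OF g_int] by simp
    have fgA: "(\<lambda>z. f z - g z) contour_integrable_on A" using fA gA by (rule contour_integrable_diff)
    have 3: "contour_integral A f - contour_integral A g = contour_integral A (\<lambda>z. f z - g z)"
      using contour_integral_diff[OF fA gA] by simp
    have diff: "2 * of_real pi * \<i> * (F 1 - S N 1) = contour_integral A (\<lambda>z. f z - g z) - contour_integral L g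
        + (contour_integral (linepath p1 p2) f + contour_integral (linepath p2 p3) f + contour_integral (linepath p3 p4) f)"
      using 1 2 3 by (simp add: algebra_simps)
    have normN: "norm (of_nat N powr z :: complex) = real N powr Re z" for z by (rule norm_of_nat_powr)
    have bA: "norm (contour_integral A (\<lambda>z. f z - g z)) \<le> 2 * C / R^2 * R * \<bar>pi/2 - (-pi/2)\<bar>"
      unfolding A_def
    proof (rule contour_integral_bound_part_circlepath)
      show "norm (f z - g z) \<le> 2 * C / R^2" if "z \<in> path_image (part_circlepath 0 R (- pi / 2) (pi / 2))" for z
      proof -
        have z: "norm z = R" "Re z \<ge> 0" using A that unfolding A_def by auto
        define x where "x = Re z"
        show ?thesis
        \<comment> \<open>At the ends of the arc the series is not known to converge; there the
          kernel vanishes.\<close>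
        proof (cases "x = 0")
          case True
          then have "K z = 0" using K_circ[OF z(1)] by (simp add: x_def)
          then show ?thesis using C0 by (simp add: f_def g_def)
        next
          case False
          then have x: "x > 0" using z by (simp add: x_def)
          have "(\<lambda>M. S M (1 + z)) \<longlonglongrightarrow> F (1 + z)"
            using sums[of "1 + z"] x by (simp add: sums_def_le S_def x_def)
          then have lim: "(\<lambda>M. norm (S (N + M) (1 + z) - S N (1 + z))) \<longlonglongrightarrow> norm (F (1 + z) - S N (1 + z))"
            by (intro tendsto_intros) (subst add.commute, rule LIMSEQ_ignore_initial_segment)
          have "norm (S (N + M) (1 + z) - S N (1 + z)) \<le> C * (real N powr (-x) / x)" for M
          proof -
            have re: "Re (-(1+z)) = -x - 1" by (simp add: x_def)
            have "S (N + M) (1 + z) = S N (1 + z) + (\<Sum>n\<in>{N<..N+M}. a n * of_nat n powr (-(1+z)))"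
              unfolding S_def by (subst sum.union_disjoint[symmetric]) (auto intro!: sum.cong)
            then have "norm (S (N + M) (1 + z) - S N (1 + z)) \<le> (\<Sum>n\<in>{N<..N+M}. norm (a n * of_nat n powr (-(1+z))))"
              by (simp only: add_diff_cancel_left' norm_sum)
            also have "\<dots> \<le> (\<Sum>n\<in>{N<..N+M}. C * real n powr (-x-1))"
              by (intro sum_mono, subst norm_mult, subst norm_of_nat_powr, subst re, intro mult_right_mono C) auto
            also have "\<dots> = C * (\<Sum>n\<in>{N<..N+M}. real n powr (-x-1))" by (simp add: sum_distrib_left)
            also have "\<dots> \<le> C * (real N powr (-x) / x)"
              using sum_powr_tail_le[OF x N, of M] C0 by (intro mult_left_mono) auto
            finally show ?thesis .
          qed
          then have r: "norm (F (1 + z) - S N (1 + z)) \<le> C * (real N powr (-x) / x)"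
            by (intro tendsto_upperbound[OF lim]) auto
          \<comment> \<open>Everything cancels: \<open>N powr x\<close> against
            \<open>N powr (-x)\<close> from the tail, \<open>1 / x\<close> against
            \<open>2 * x / R^2\<close> from the kernel. The bound is uniform on the arc.\<close>
          have "f z - g z = (F (1 + z) - S N (1 + z)) * of_nat N powr z * K z"
            by (simp add: f_def g_def H_def algebra_simps)
          then have "norm (f z - g z) = norm (F (1 + z) - S N (1 + z)) * real N powr x * (2 * x / R^2)"
            using x unfolding K_circ[OF z(1)] by (simp add: norm_mult normN x_def norm_divide norm_power)
          also have "\<dots> \<le> (C * (real N powr (-x) / x)) * real N powr x * (2 * x / R^2)"
            using r x by (intro mult_right_mono) auto
          also have "\<dots> = 2 * C / R^2 * (real N powr (-x) * real N powr x)" using x by (simp add: field_simps)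
          also have "real N powr (-x) * real N powr x = 1" using N by (simp add: powr_minus)
          finally show ?thesis by simp
        qed
      qed
    qed (use fgA C0 R in \<open>auto simp: A_def\<close>)
    have bL: "norm (contour_integral L g) \<le> (2 * C / R^2 + 2 * C / (real N * R)) * R * \<bar>3*pi/2 - pi/2\<bar>"
      unfolding L_def
    proof (rule contour_integral_bound_part_circlepath)
      show "norm (g z) \<le> 2 * C / R^2 + 2 * C / (real N * R)" if "z \<in> path_image (part_circlepath 0 R (pi/2) (3 * pi / 2))" for z
      proof -
        have z: "norm z = R" "Re z \<le> 0" using L that unfolding L_def by auto
        define x where "x = - Re z"
        have xR: "x \<le> R" using z abs_Re_le_cmod[of z] by (simp add: x_def)
        show ?thesis
        proof (cases "x = 0")
          case True
          then have "K z = 0" using K_circ[OF z(1)] by (simp add: x_def)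
          then show ?thesis using C0 R by (simp add: g_def)
        next
          case False
          then have x: "x > 0" using z by (simp add: x_def)
          have re: "Re (-(1+z)) = x - 1" by (simp add: x_def)
          have "norm (S N (1 + z)) \<le> (\<Sum>n\<le>N. norm (a n * of_nat n powr (-(1+z))))"
            unfolding S_def by (rule norm_sum)
          also have "\<dots> \<le> (\<Sum>n\<le>N. C * real n powr (x-1))"
            by (intro sum_mono, subst norm_mult, subst norm_of_nat_powr, subst re, intro mult_right_mono C) auto
          also have "\<dots> = C * (\<Sum>n\<le>N. real n powr (x-1))" by (simp add: sum_distrib_left)
          also have "(\<Sum>n\<le>N. real n powr (x-1)) = (\<Sum>n=1..N. real n powr (x-1))"
            by (intro sum.mono_neutral_right) auto
          also have "\<dots> \<le> real N powr x * (1 / x + 1 / real N)"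
            using sum_powr_le[OF x, of "N - 1"] N by simp
          finally have s: "norm (S N (1 + z)) \<le> C * (real N powr x * (1 / x + 1 / real N))" using C0 by (simp add: mult_left_mono)
          have "norm (g z) = norm (S N (1 + z)) * real N powr (-x) * (2 * x / R^2)"
            using x unfolding g_def K_circ[OF z(1)] by (simp add: norm_mult normN x_def norm_divide norm_power)
          also have "\<dots> \<le> (C * (real N powr x * (1 / x + 1 / real N))) * real N powr (-x) * (2 * x / R^2)"
            using s x by (intro mult_right_mono) auto
          also have "\<dots> = (real N powr x * real N powr (-x)) * (C * (1 / x + 1 / real N) * (2 * x / R^2))" by (simp add: mult_ac)
          also have "real N powr x * real N powr (-x) = 1" using N by (simp add: powr_minus)
          \<comment> \<open>The part with \<open>1 / x\<close> loses its x to the kernel; the part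
            with \<open>1 / N\<close> keeps a factor \<open>x / R\<close>, which is at most
            1.\<close>
          also have "1 * (C * (1 / x + 1 / real N) * (2 * x / R^2)) = 2 * C / R^2 + (2 * C / (real N * R)) * (x / R)"
            using x N R by (simp add: field_simps power2_eq_square)
          also have "\<dots> \<le> 2 * C / R^2 + (2 * C / (real N * R)) * 1"
            using xR R C0 N by (intro add_left_mono mult_left_mono) auto
          finally show ?thesis by simp
        qed
      qed
    qed (use gL C0 R in \<open>auto simp: L_def\<close>)
    have bK: "norm (K z) \<le> 3 / R" if "\<bar>Im z\<bar> = R" "-\<eta> \<le> Re z" "Re z \<le> 0" for z
    proof -
      have "norm z \<ge> R" using that abs_Im_le_cmod[of z] by simp
      moreover have "norm z \<le> 2 * R" using cmod_le[of z] that \<eta> by auto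
      ultimately have "norm (1 / z) \<le> 1 / R" "norm (z / of_real R ^ 2) \<le> 2 / R"
        using R by (simp_all add: norm_divide norm_power norm_mult divide_simps power2_eq_square)
      then show ?thesis unfolding K_def using norm_triangle_ineq[of "1 / z" "z / of_real R ^ 2"] by simp
    qed
    have bh: "norm (f z) \<le> M * 1 * (3 / R)" if "z \<in> Q" "\<bar>Im z\<bar> = R" "-\<eta> \<le> Re z" "Re z \<le> 0" for z
    proof -
      have "real N powr Re z \<le> real N powr 0" using that N by (intro powr_mono) auto
      then show ?thesis unfolding f_def norm_mult normN using bK[OF that(2-4)] M that(1) N R by (intro mult_mono) auto
    qed
    have b12: "norm (contour_integral (linepath p1 p2) f) \<le> M * 1 * (3 / R) * norm (p2 - p1)"
      by (rule contour_integral_bound_linepath[OF f12]) (use M R seg12 segQ bh in auto)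
    have b34: "norm (contour_integral (linepath p3 p4) f) \<le> M * 1 * (3 / R) * norm (p4 - p3)"
      by (rule contour_integral_bound_linepath[OF f34]) (use M R seg34 segQ bh in auto)
    have b23: "norm (contour_integral (linepath p2 p3) f) \<le> M * real N powr (-\<eta>) * (1 / \<eta> + 2 / R) * norm (p3 - p2)"
    proof (rule contour_integral_bound_linepath[OF f23])
      show "0 \<le> M * real N powr (-\<eta>) * (1 / \<eta> + 2 / R)" using M \<eta> R by simp
      fix z assume z: "z \<in> closed_segment p2 p3"
      have "norm z \<ge> \<eta>" using seg23[OF z] abs_Re_le_cmod[of z] by simp
      moreover have "norm z \<le> 2 * R" using cmod_le[of z] seg23[OF z] \<eta> by auto
      ultimately have "norm (1 / z) \<le> 1 / \<eta>" "norm (z / of_real R ^ 2) \<le> 2 / R"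
        using R \<eta> by (simp_all add: norm_divide norm_power norm_mult divide_simps power2_eq_square)
      then have "norm (K z) \<le> 1 / \<eta> + 2 / R" unfolding K_def using norm_triangle_ineq[of "1 / z" "z / of_real R ^ 2"] by simp
      then show "norm (f z) \<le> M * real N powr (-\<eta>) * (1 / \<eta> + 2 / R)"
        unfolding f_def norm_mult normN using M segQ[of z] z seg23[OF z] by (intro mult_mono) auto
    qed
    have lens: "norm (p2 - p1) = \<eta>" "norm (p4 - p3) = \<eta>" "norm (p3 - p2) = 2 * R"
      using \<eta> R by (simp_all add: p1_def p2_def p3_def p4_def cmod_def real_sqrt_mult)
    have "2 * pi * norm (F 1 - S N 1) = norm (2 * of_real pi * \<i> * (F 1 - S N 1))"
      by (simp add: norm_mult)
    also have "\<dots> \<le> norm (contour_integral A (\<lambda>z. f z - g z)) + norm (contour_integral L g)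
        + (norm (contour_integral (linepath p1 p2) f) + norm (contour_integral (linepath p2 p3) f) + norm (contour_integral (linepath p3 p4) f))"
      unfolding diff by (intro norm_triangle_le norm_triangle_le_diff add_mono order_refl)
    also have "\<dots> \<le> 2 * C / R^2 * R * \<bar>pi/2 - (-pi/2)\<bar> + (2 * C / R^2 + 2 * C / (real N * R)) * R * \<bar>3*pi/2 - pi/2\<bar>
       + (M * 1 * (3 / R) * \<eta> + M * real N powr (-\<eta>) * (1 / \<eta> + 2 / R) * (2 * R) + M * 1 * (3 / R) * \<eta>)"
      using bA bL b12 b34 b23 unfolding lens by (intro add_mono) auto
    also have "\<dots> = 2 * pi * (2 * C / R + C / real N) + (6 * M * \<eta> / R + 2 * R * (M * real N powr (-\<eta>) * (1 / \<eta> + 2 / R)))"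
    proof -
      have "\<bar>pi/2 - (-pi/2)\<bar> = pi" "\<bar>3*pi/2 - pi/2\<bar> = pi" using pi_gt_zero by auto
      moreover have "2 * C / R^2 * R * pi + (2 * C / R^2 + 2 * C / (real N * R)) * R * pi = 2 * pi * (2 * C / R + C / real N)"
        using R N by (simp add: field_simps power2_eq_square)
      ultimately show ?thesis by (simp add: algebra_simps)
    qed
    finally show ?thesis by (simp add: field_simps)
  qed
  have "(\<lambda>N. 2 * R * (M * real N powr (-\<eta>) * (1 / \<eta> + 2 / R))) \<longlonglongrightarrow> 2 * R * (M * 0 * (1 / \<eta> + 2 / R))"
    using \<eta>(1) by (intro tendsto_intros) (real_asymp simp: \<eta>(1))
  then have "\<forall>\<^sub>F N in sequentially. 2 * R * (M * real N powr (-\<eta>) * (1 / \<eta> + 2 / R)) < \<epsilon>"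
    using \<epsilon> by (intro order_tendstoD(2)) auto
  then show ?thesis using eventually_gt_at_top[of 0]
  proof eventually_elim
    case (elim N)
    have "6 * M * \<eta> / R \<le> \<epsilon>" using \<eta>(4) M R by (simp add: field_simps)
    then have "(6 * M * \<eta> / R + 2 * R * (M * real N powr (-\<eta>) * (1 / \<eta> + 2 / R))) / (2 * pi) \<le> (2 * \<epsilon>) / (2 * pi)"
      using elim by (intro divide_right_mono) auto
    also have "\<dots> \<le> \<epsilon>" using \<epsilon> pi_gt3 by (simp add: field_simps)
    finally show ?case using main[of N] elim by (simp add: S_def)
  qed
qed

text \<open>For fixed R, letting N grow leaves an error of about \<open>2 * C / R\<close>. R is
  arbitrary because F is holomorphic on a neighbourhood of the whole closed half-plane.\<close>

theorem newman_tauberian: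
  fixes a :: "nat \<Rightarrow> complex"
  assumes C: "\<And>n. norm (a n) \<le> C" and U: "open U" "{s. Re s \<ge> 1} \<subseteq> U" and F: "F holomorphic_on U"
    and sums: "\<And>s. Re s > 1 \<Longrightarrow> (\<lambda>n. a n * of_nat n powr (-s)) sums F s"
  shows "(\<lambda>n. a n * of_nat n powr (-1)) sums F 1"
  unfolding sums_def_le
proof (rule tendstoI)
  fix e :: real assume e: "e > 0"
  have C0: "C \<ge> 0" using order_trans[OF norm_ge_zero C[of 0]] .
  \<comment> \<open>Makes \<open>2 * C / R\<close> at most a quarter of e; \<open>C + 1\<close>
    keeps R positive when C is 0.\<close>
  define R where "R = 8 * (C + 1) / e"
  have R: "R > 0" using C0 e by (simp add: R_def)
  have CR: "2 * C / R \<le> e / 4" using C0 e by (simp add: R_def field_simps)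
  have "(\<lambda>N. C / real N) \<longlonglongrightarrow> 0" by real_asymp
  then have "\<forall>\<^sub>F N in sequentially. C / real N < e / 4" using e by (intro order_tendstoD) auto
  moreover have "\<forall>\<^sub>F N in sequentially. norm (F 1 - (\<Sum>n\<le>N. a n * of_nat n powr (-1))) \<le> 2 * C / R + C / real N + e / 4"
    using newman_estimate[OF C U F sums R, of "e/4"] e by auto
  ultimately show "\<forall>\<^sub>F N in sequentially. dist (\<Sum>n\<le>N. a n * of_nat n powr (-1)) (F 1) < e"
  proof eventually_elim
    case (elim N)
    then have "norm (F 1 - (\<Sum>n\<le>N. a n * of_nat n powr (-1))) < e" using CR e by linarith
    then show ?case by (simp only: dist_norm norm_minus_commute)
  qed
qed

section \<open>Chebyshev's bound\<close>

definition psi :: "nat \<Rightarrow> real" where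
  "psi n = (\<Sum>k\<le>n. mangoldt k)"

lemma psi_mono: "m \<le> n \<Longrightarrow> psi m \<le> psi n"
  unfolding psi_def by (intro sum_mono2) (auto simp: mangoldt_nonneg)

lemma psi_nonneg: "psi n \<ge> 0"
  unfolding psi_def by (intro sum_nonneg) (auto simp: mangoldt_nonneg)

lemma psi_0 [simp]: "psi 0 = 0" by (simp add: psi_def)

lemma psi_Suc: "psi (Suc n) = psi n + mangoldt (Suc n)" by (simp add: psi_def)

lemma card_multiples: "d > 0 \<Longrightarrow> card {k\<in>{1..n}. d dvd k} = n div (d::nat)"
proof -
  assume d: "d > 0"
  have "{k\<in>{1..n}. d dvd k} = (\<lambda>j. d * j) ` {1..n div d}"
  proof (intro equalityI subsetI)
    fix k assume "k \<in> {k\<in>{1..n}. d dvd k}"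
    then obtain j where j: "k = d * j" "1 \<le> k" "k \<le> n" by auto
    have "j \<le> n div d" using j d by (simp add: less_eq_div_iff_mult_less_eq mult.commute)
    moreover have "j \<ge> 1" using j by (cases j) auto
    ultimately show "k \<in> (\<lambda>j. d * j) ` {1..n div d}" using j by auto
  next
    fix k assume "k \<in> (\<lambda>j. d * j) ` {1..n div d}"
    then show "k \<in> {k\<in>{1..n}. d dvd k}" using d by (auto simp: less_eq_div_iff_mult_less_eq mult.commute Suc_le_eq)
  qed
  moreover have "card ((\<lambda>j. d * j) ` {1..n div d}) = n div d"
    using d by (subst card_image) (auto simp: inj_on_def)
  ultimately show ?thesis by simp
qed

text \<open>Every divisor d of k contributes \<open>mangoldt d\<close> to \<open>ln k\<close>, and d
  has \<open>n div d\<close> multiples up to n. The free upper limit N lets the sums for n and 2n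
  run over the same range; summands with d > n are 0.\<close>

lemma ln_fact_eq_sum_mangoldt:
  assumes "n \<le> N"
  shows "ln (fact n) = (\<Sum>d=1..N. mangoldt d * real (n div d))"
proof -
  have "ln (fact n :: real) = (\<Sum>k=1..n. ln (real k))"
    by (induction n) (auto simp: ln_mult)
  also have "\<dots> = (\<Sum>k=1..n. \<Sum>d | d dvd k. mangoldt d)"
    using mangoldt_sum[where 'a = real] by (intro sum.cong) auto
  also have "\<dots> = (\<Sum>k=1..n. \<Sum>d\<in>{1..N}. if d dvd k then mangoldt d else 0)"
  proof (rule sum.cong[OF refl])
    fix k assume k: "k \<in> {1..n}"
    then have "{d. d dvd k} = {d\<in>{1..N}. d dvd k}" using assms by (auto dest: dvd_imp_le intro: Suc_leI dvd_pos_nat)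
    then show "(\<Sum>d | d dvd k. mangoldt d) = (\<Sum>d\<in>{1..N}. if d dvd k then mangoldt d else (0::real))"
      by (simp only: sum.inter_filter finite_atLeastAtMost)
  qed
  also have "\<dots> = (\<Sum>d\<in>{1..N}. \<Sum>k=1..n. if d dvd k then mangoldt d else 0)" by (rule sum.swap)
  also have "\<dots> = (\<Sum>d=1..N. mangoldt d * real (n div d))"
  proof (rule sum.cong[OF refl])
    fix d assume "d \<in> {1..N}"
    then have d: "d > 0" by auto
    have "(\<Sum>k=1..n. if d dvd k then mangoldt d else (0::real)) = (\<Sum>k\<in>{k\<in>{1..n}. d dvd k}. mangoldt d)"
      by (simp only: sum.inter_filter finite_atLeastAtMost)
    also have "\<dots> = mangoldt d * real (n div d)" using card_multiples[OF d, of n] by simp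
    finally show "(\<Sum>k=1..n. if d dvd k then mangoldt d else (0::real)) = mangoldt d * real (n div d)" .
  qed
  finally show ?thesis .
qed

lemma central_binomial_le: "(2 * n) choose n \<le> 4 ^ n"
proof -
  have "(2 * n) choose n \<le> (\<Sum>k\<le>2*n. (2 * n) choose k)" by (intro member_le_sum) auto
  then show ?thesis by (simp add: choose_row_sum power_mult)
qed

text \<open>Chebyshev's argument: \<open>2 * n div d - 2 * (n div d)\<close> is 1 for n < d <= 2n
  and never negative, so the difference is at most the logarithm of the central binomial
  coefficient, hence at most \<open>ln (4 ^ n)\<close>.\<close>

lemma psi_double: "psi (2 * n) - psi n \<le> real n * (2 * ln 2)"
proof -
  have "psi (2 * n) = psi n + (\<Sum>d\<in>{n<..2*n}. mangoldt d)"
    unfolding psi_def by (subst sum.union_disjoint[symmetric]) (auto intro!: sum.cong)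
  then have "psi (2 * n) - psi n = (\<Sum>d\<in>{n<..2*n}. mangoldt d)" by simp
  also have "\<dots> \<le> (\<Sum>d\<in>{n<..2*n}. mangoldt d * (real (2 * n div d) - 2 * real (n div d)))"
  proof (intro sum_mono)
    fix d assume "d \<in> {n<..2*n}"
    then have "2 * n div d = 1" "n div d = 0" by (auto intro: div_nat_eqI)
    then show "mangoldt d \<le> mangoldt d * (real (2 * n div d) - 2 * real (n div d))" by simp
  qed
  also have "\<dots> \<le> (\<Sum>d=1..2*n. mangoldt d * (real (2 * n div d) - 2 * real (n div d)))"
  proof (intro sum_mono2)
    fix d assume "d \<in> {1..2 * n} - {n<..2 * n}"
    have "2 * (n div d) \<le> 2 * n div d"
      by (cases "d = 0") (auto simp: less_eq_div_iff_mult_less_eq)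
    then have "2 * real (n div d) \<le> real (2 * n div d)" by linarith
    then show "0 \<le> mangoldt d * (real (2 * n div d) - 2 * real (n div d))" by (simp add: mangoldt_nonneg)
  qed auto
  also have "\<dots> = ln (fact (2 * n)) - 2 * ln (fact n)"
    by (subst (1 2) ln_fact_eq_sum_mangoldt[of _ "2 * n"])
       (auto simp: sum_distrib_left right_diff_distrib sum_subtractf algebra_simps)
  also have "\<dots> = ln (real ((2 * n) choose n))"
  proof -
    have "real ((2 * n) choose n) = fact (2 * n) / (fact n * fact n)" by (simp add: binomial_fact mult_2)
    then show ?thesis by (simp add: ln_div ln_mult)
  qed
  also have "\<dots> \<le> ln (real (4 ^ n))"
  proof -
    have "real ((2 * n) choose n) \<le> real (4 ^ n)"
      using central_binomial_le[of n] by (simp only: of_nat_le_iff)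
    moreover have "(2 * n) choose n > 0" by simp
    ultimately show ?thesis by (intro ln_mono) (simp_all only: of_nat_0_less_iff)
  qed
  also have "\<dots> = real n * (2 * ln 2)" using ln_realpow[of 2 2] by (simp add: ln_realpow)
  finally show ?thesis .
qed

text \<open>Strong induction through \<open>psi_double\<close> at half of n, rounded up. Any
  constant would serve Newman's theorem; 4 leaves room for the rounding.\<close>

lemma psi_le: "psi n \<le> 4 * real n"
proof (induction n rule: less_induct)
  case (less n)
  have l2: "2 * ln 2 \<le> (3/2::real)" using ln2_le_25_over_36 by simp
  show ?case
  proof (cases "n \<le> 1")
    case True then show ?thesis by (cases n) (auto simp: psi_def)
  next
    case False
    define m where "m = (n + 1) div 2"
    have m: "m < n" "n \<le> 2 * m" "2 * m \<le> n + 1" "n \<ge> 2" using False by (auto simp: m_def)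
    have "psi n \<le> psi (2 * m)" using m by (intro psi_mono) auto
    also have "\<dots> \<le> psi m + real m * (2 * ln 2)" using psi_double[of m] by simp
    also have "\<dots> \<le> 4 * real m + real m * (3/2)" using less[OF m(1)] l2 by (intro add_mono mult_left_mono) auto
    also have "\<dots> \<le> 4 * real n"
    proof -
      have "2 * real m \<le> real n + 1" "real n \<ge> 2" using m by linarith+
      moreover have "n = 2 \<Longrightarrow> m = 1" by (simp add: m_def)
      \<comment> \<open>With \<open>2 * m \<le> n + 1\<close> the bound
        \<open>4 * m + 3 / 2 * m\<close> stays below \<open>4 * n\<close> from n = 3 on; n = 2,
        where m = 1, is checked apart.\<close>
      ultimately show ?thesis by (cases "n = 2") (use m in linarith)+
    qed
    finally show ?thesis .
  qed
qed

section \<open>The prime number theorem\<close>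

text \<open>Summation by parts; the boundary term tends to 0 because
  \<open>psi N \<le> 4 * N\<close> and \<open>Re s > 1\<close>.\<close>

lemma mangoldt_abel_sums:
  assumes s: "Re s > 1"
  shows "(\<lambda>n. of_real (psi n) * (of_nat n powr (-s) - of_nat (Suc n) powr (-s))) sums mangoldt_series s"
proof -
  have abel: "(\<Sum>n\<le>N. of_real (psi n) * (of_nat n powr (-s) - of_nat (Suc n) powr (-s))) =
     (\<Sum>n\<le>N. mangoldt n * of_nat n powr (-s)) - of_real (psi N) * of_nat (Suc N) powr (-s)" for N
    by (induction N) (simp_all add: psi_Suc algebra_simps)
  have "(\<lambda>N. of_real (psi N) * of_nat (Suc N) powr (-s)) \<longlonglongrightarrow> (0 :: complex)"
  proof (rule Lim_null_comparison)
    show "\<forall>\<^sub>F N in sequentially. norm (of_real (psi N) * of_nat (Suc N) powr (-s) :: complex) \<le> 4 * real N * real (Suc N) powr (- Re s)"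
      using psi_le psi_nonneg by (intro always_eventually allI) (simp add: norm_mult norm_of_nat_powr mult_right_mono del: of_nat_Suc)
    show "(\<lambda>N. 4 * real N * real (Suc N) powr (- Re s)) \<longlonglongrightarrow> 0" using s by real_asymp
  qed
  moreover have "(\<lambda>N. \<Sum>n\<le>N. mangoldt n * of_nat n powr (-s)) \<longlonglongrightarrow> mangoldt_series s"
    using mangoldt_series_sums[OF s] by (simp add: sums_def_le)
  ultimately have "(\<lambda>N. (\<Sum>n\<le>N. mangoldt n * of_nat n powr (-s)) - of_real (psi N) * of_nat (Suc N) powr (-s)) \<longlonglongrightarrow> mangoldt_series s - 0"
    by (intro tendsto_diff)
  then show ?thesis unfolding sums_def_le abel by simp
qed

text \<open>For \<open>Re s > 1\<close> the series with coefficients \<open>psi n / n - 1\<close> is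
  \<open>(mangoldt_series s + E (s + 1)) / s - zeta s\<close>. Both \<open>mangoldt_series\<close>
  and \<open>zeta\<close> have residue 1 at 1, so the poles cancel, and non-vanishing of
  \<open>pole_free_zeta\<close> provides the open set U for Newman's theorem.\<close>

lemma summable_psi_error: "summable (\<lambda>n. (psi n / real n - 1) / real n)"
proof -
  define b where "b = (\<lambda>n. complex_of_real (psi n))"
  \<comment> \<open>\<open>zrem n (s + 1)\<close> is exactly \<open>s * n powr (-s - 1)\<close>
    minus \<open>n powr (-s) - Suc n powr (-s)\<close>; \<open>E (s + 1)\<close> sums these errors
    with weight \<open>psi n\<close>.\<close>
  define E where "E = (\<lambda>s. \<Sum>n. b n * zrem n s)"
  have b: "norm (b n) \<le> 4 * real n ^ 1" for n using psi_le[of n] psi_nonneg[of n] by (simp add: b_def)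
  have E: "E holomorphic_on {s. Re s > 1}" unfolding E_def using weighted_zrem_holomorphic[OF b] by simp
  define U where "U = {s. Re s > 0 \<and> pole_free_zeta s \<noteq> 0}"
  have U: "open U"
  proof -
    have "open ({s. Re s > 0} \<inter> pole_free_zeta -` (-{0}))"
      using holomorphic_on_imp_continuous_on[OF pole_free_zeta_holomorphic] open_Re_gt by (intro continuous_open_preimage) auto
    moreover have "U = {s. Re s > 0} \<inter> pole_free_zeta -` (-{0})" by (auto simp: U_def)
    ultimately show ?thesis by simp
  qed
  have ZU: "pole_free_zeta holomorphic_on U" by (rule holomorphic_on_subset[OF pole_free_zeta_holomorphic]) (auto simp: U_def)
  \<comment> \<open>The polar parts combine to \<open>(1 - s * pole_free_zeta s) / (s - 1)\<close>.
    W vanishes at 1 since \<open>pole_free_zeta 1 = 1\<close>, and q is this quotient with the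
    removable singularity filled in.\<close>
  define W where "W = (\<lambda>s. 1 - s * pole_free_zeta s)"
  define q where "q = (\<lambda>z. if z = 1 then deriv W 1 else (W z - W 1) / (z - 1))"
  have "W holomorphic_on U" unfolding W_def by (intro holomorphic_intros ZU)
  then have q: "q holomorphic_on U" unfolding q_def by (rule pole_lemma_open[OF _ U])
  define F where "F = (\<lambda>s. (q s - deriv pole_free_zeta s / pole_free_zeta s + E (s + 1)) / s)"
  have "(\<lambda>s. s + 1) holomorphic_on U" by (intro holomorphic_intros)
  then have "(E \<circ> (\<lambda>s. s + 1)) holomorphic_on U"
    by (rule holomorphic_on_compose_gen[OF _ E]) (auto simp: U_def)
  then have EU: "(\<lambda>s. E (s + 1)) holomorphic_on U" by (simp add: o_def)
  have F: "F holomorphic_on U" unfolding F_def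
    by (intro holomorphic_intros q EU ZU holomorphic_deriv[OF ZU U]) (auto simp: U_def)
  define a where "a = (\<lambda>n. complex_of_real (psi n / real n - 1))"
  have a: "norm (a n) \<le> 5" for n
  proof -
    have "0 \<le> psi n / real n" "psi n / real n \<le> 4" using psi_le[of n] psi_nonneg[of n] by (auto simp: divide_simps)
    then show ?thesis unfolding a_def norm_of_real by linarith
  qed
  have sums: "(\<lambda>n. a n * of_nat n powr (-s)) sums F s" if s: "Re s > 1" for s
  proof -
    have s0: "s \<noteq> 0" "s \<noteq> 1" using s by auto
    have "(\<lambda>n. b n * zrem n (s + 1)) sums E (s + 1)"
      unfolding E_def by (rule weighted_zrem_sums[OF b]) (use s in auto)
    from sums_add[OF this mangoldt_abel_sums[OF s]]
    have "(\<lambda>n. b n * zrem n (s + 1) + b n * (of_nat n powr (-s) - of_nat (Suc n) powr (-s))) sums (E (s + 1) + mangoldt_series s)"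
      by (simp add: b_def)
    moreover have "b n * zrem n (s + 1) + b n * (of_nat n powr (-s) - of_nat (Suc n) powr (-s)) = b n * of_nat n powr (-s-1) * s" for n
    proof -
      have e: "1 - (s + 1) = -s" "-(s + 1) = -s - 1" by simp_all
      show ?thesis unfolding zrem_def e by (simp add: algebra_simps del: of_nat_Suc)
    qed
    ultimately have "(\<lambda>n. b n * of_nat n powr (-s-1) * s) sums (E (s + 1) + mangoldt_series s)" by simp
    from sums_diff[OF sums_divide[OF this, of s] zeta_sums[OF s]]
    have "(\<lambda>n. b n * of_nat n powr (-s-1) - of_nat n powr (-s)) sums ((E (s + 1) + mangoldt_series s) / s - zeta s)"
      using s0 by simp
    moreover have "b n * of_nat n powr (-s-1) - of_nat n powr (-s) = a n * of_nat n powr (-s)" for n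
    proof (cases "n = 0")
      case False
      then have "of_nat n powr (-s-1) = of_nat n powr (-s) / (of_nat n :: complex)" by (simp add: powr_diff)
      then show ?thesis by (simp add: a_def b_def algebra_simps)
    qed (simp add: b_def)
    moreover have "(E (s + 1) + mangoldt_series s) / s - zeta s = F s"
    proof -
      have "zeta s = pole_free_zeta s / (s - 1)" using pole_free_zeta_eq[OF s] s0 by simp
      moreover have "q s = 1 / (s - 1) - s * pole_free_zeta s / (s - 1)"
        using s0 by (simp add: q_def W_def pole_free_zeta_1 diff_divide_distrib)
      ultimately show ?thesis unfolding F_def mangoldt_series_eq[OF s] using s0 by (simp add: add_divide_distrib diff_divide_distrib)
    qed
    ultimately show ?thesis by simp
  qed
  have "(\<lambda>n. a n * of_nat n powr (-1)) sums F 1"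
    by (rule newman_tauberian[OF a U _ F sums]) (use pole_free_zeta_nonzero_ge1 in \<open>auto simp: U_def\<close>)
  then have "summable (\<lambda>n. Re (a n * of_nat n powr (-1)))" using sums_Re sums_summable by blast
  moreover have "a n * of_nat n powr (-1) = of_real ((psi n / real n - 1) / real n)" for n
    by (cases "n = 0") (simp_all add: a_def powr_minus divide_simps)
  ultimately show ?thesis by simp
qed

text \<open>If f N were at least \<open>(1 + 2 * \<delta>) * N\<close>, monotonicity would keep
  \<open>f k - k\<close> at least \<open>\<delta> * N\<close> for all k from N to
  \<open>(1 + \<delta>) * N\<close>, and this block alone would violate the Cauchy criterion. A
  deficit is excluded by the block that ends at N.\<close>

lemma mono_tauberian:
  fixes f :: "nat \<Rightarrow> real"
  assumes f: "mono f" and summ: "summable (\<lambda>n. (f n / real n - 1) / real n)"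
  shows "(\<lambda>n. f n / real n) \<longlonglongrightarrow> 1"
proof (rule tendstoI)
  fix e :: real assume e: "e > 0"
  define \<delta> where "\<delta> = min (e/2) (1/2)"
  have \<delta>: "\<delta> > 0" "\<delta> \<le> 1/2" "2 * \<delta> \<le> e" using e by (auto simp: \<delta>_def)
  define c where "c = (\<lambda>n. (f n / real n - 1) / real n)"
  \<comment> \<open>What the upper block contributes at least: more than \<open>\<delta> * N\<close>
    terms, each at least \<open>\<delta> * N / ((1 + \<delta>) * N)^2\<close>. The lower block gives
    \<open>\<delta>^2\<close>, which is no smaller.\<close>
  define r where "r = \<delta>^2 / (1+\<delta>)^2"
  have r: "r > 0" "r \<le> \<delta>^2" using \<delta> by (auto simp: r_def divide_simps mult_le_cancel_left1)
  obtain N0 where N0: "\<And>m n. m \<ge> N0 \<Longrightarrow> norm (\<Sum>k\<in>{m..<n}. c k) < r"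
    using summ[folded c_def, unfolded summable_Cauchy] r(1) by blast
  have ceq: "c k = (f k - real k) / real k ^ 2" if "k > 0" for k
    using that by (simp add: c_def field_simps power2_eq_square)
  \<comment> \<open>\<open>2 * N0\<close> because the lower block starts at \<open>N - m\<close>,
    which is at least half of N.\<close>
  have main: "\<bar>f N / real N - 1\<bar> < 2 * \<delta>" if N: "N > 0" "N \<ge> 2 * N0" for N
  proof -
    define m where "m = nat \<lfloor>\<delta> * real N\<rfloor>"
    have m: "real m \<le> \<delta> * real N" "real m + 1 > \<delta> * real N"
      using \<delta> N by (auto simp: m_def intro!: mult_nonneg_nonneg)
    have "\<delta> * real N \<le> 1/2 * real N" using \<delta> by (intro mult_right_mono) auto
    then have mN: "2 * m \<le> N" using m by linarith
    have sq: "\<delta> * real N * (\<delta> * real N) \<le> (real m + 1) * (\<delta> * real N)" using m \<delta> N by (intro mult_right_mono) auto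
    have up: "f N < (1 + 2 * \<delta>) * real N"
    proof (rule ccontr)
      assume "\<not> ?thesis"
      then have fN: "f N \<ge> (1 + 2 * \<delta>) * real N" by simp
      have "c k \<ge> \<delta> * real N / ((1 + \<delta>) * real N)^2" if k: "k \<in> {N..<N+m+1}" for k
      proof -
        have k2: "real k \<le> (1 + \<delta>) * real N" "real k > 0" "N \<le> k" using k m N by (auto simp: algebra_simps)
        have "f k \<ge> f N" using f k2 by (simp add: monoD)
        then have "f k - real k \<ge> \<delta> * real N" using fN k2 by (simp add: algebra_simps)
        moreover have "real k ^ 2 \<le> ((1 + \<delta>) * real N)^2" using k2 by (intro power_mono) auto
        moreover have "0 \<le> \<delta> * real N" using \<delta> by simp
        ultimately have "\<delta> * real N / ((1 + \<delta>) * real N)^2 \<le> (f k - real k) / real k ^ 2"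
          using k2 by (intro frac_le) auto
        then show ?thesis using k2 by (subst ceq) auto
      qed
      then have "(\<Sum>k\<in>{N..<N+m+1}. c k) \<ge> (\<Sum>k\<in>{N..<N+m+1}. \<delta> * real N / ((1 + \<delta>) * real N)^2)" by (intro sum_mono) auto
      also have "(\<Sum>k\<in>{N..<N+m+1}. \<delta> * real N / ((1 + \<delta>) * real N)^2) = (real m + 1) * (\<delta> * real N) / ((1 + \<delta>) * real N)^2" by simp
      finally have "(real m + 1) * (\<delta> * real N) / ((1 + \<delta>) * real N)^2 \<le> (\<Sum>k\<in>{N..<N+m+1}. c k)" .
      moreover have "\<delta> * real N * (\<delta> * real N) / ((1 + \<delta>) * real N)^2 \<le> (real m + 1) * (\<delta> * real N) / ((1 + \<delta>) * real N)^2"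
        using sq by (intro divide_right_mono) auto
      moreover have "\<delta> * real N * (\<delta> * real N) / ((1 + \<delta>) * real N)^2 = r"
        using N \<delta> by (simp add: r_def power_mult_distrib power2_eq_square)
      ultimately have "r \<le> (\<Sum>k\<in>{N..<N+m+1}. c k)" by linarith
      moreover have "norm (\<Sum>k\<in>{N..<N+m+1}. c k) < r" using N by (intro N0) auto
      ultimately show False by simp
    qed
    have lo: "f N > (1 - 2 * \<delta>) * real N"
    proof (rule ccontr)
      assume "\<not> ?thesis"
      then have fN: "f N \<le> (1 - 2 * \<delta>) * real N" by simp
      have "c k \<le> - (\<delta> * real N / real N^2)" if k: "k \<in> {N-m..<N+1}" for k
      proof -
        have "real k \<ge> real N - real m" using k mN by auto
        moreover have "k > 0" using k mN N by (cases "m = N") auto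
        ultimately have k2: "real k \<ge> (1 - \<delta>) * real N" "k > 0" "k \<le> N" using k m by (auto simp: algebra_simps)
        have "f k \<le> f N" using f k2 by (simp add: monoD)
        then have "real k - f k \<ge> \<delta> * real N" using fN k2 by (simp add: algebra_simps)
        moreover have "real k ^ 2 \<le> real N^2" using k2 by (intro power_mono) auto
        moreover have "0 \<le> \<delta> * real N" using \<delta> by simp
        ultimately have "(real k - f k) / real k ^ 2 \<ge> \<delta> * real N / real N^2" using k2 by (intro frac_le) auto
        then show ?thesis using k2 by (subst ceq) (auto simp: diff_divide_distrib)
      qed
      then have "(\<Sum>k\<in>{N-m..<N+1}. c k) \<le> (\<Sum>k\<in>{N-m..<N+1}. - (\<delta> * real N / real N^2))" by (intro sum_mono) auto
      also have "\<dots> = - ((real m + 1) * (\<delta> * real N) / real N^2)" using mN by (simp add: of_nat_diff algebra_simps)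
      finally have "(\<Sum>k\<in>{N-m..<N+1}. c k) \<le> - ((real m + 1) * (\<delta> * real N) / real N^2)" .
      moreover have "\<delta> * real N * (\<delta> * real N) / real N^2 \<le> (real m + 1) * (\<delta> * real N) / real N^2"
        using sq by (intro divide_right_mono) auto
      moreover have "\<delta> * real N * (\<delta> * real N) / real N^2 = \<delta>^2"
        using N by (simp add: power2_eq_square)
      ultimately have "\<delta>^2 \<le> - (\<Sum>k\<in>{N-m..<N+1}. c k)" by linarith
      moreover have "norm (\<Sum>k\<in>{N-m..<N+1}. c k) < r" using N mN by (intro N0) auto
      ultimately show False using r by simp
    qed
    have "f N / real N < 1 + 2 * \<delta>" "f N / real N > 1 - 2 * \<delta>" using up lo N by (auto simp: divide_simps)
    then show ?thesis by (simp add: abs_less_iff)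
  qed
  show "\<forall>\<^sub>F n in sequentially. dist (f n / real n) 1 < e"
  proof (rule eventually_sequentiallyI[of "2 * N0 + 1"])
    fix n assume "2 * N0 + 1 \<le> n"
    then have "\<bar>f n / real n - 1\<bar> < 2 * \<delta>" by (intro main) auto
    then show "dist (f n / real n) 1 < e" using \<delta>(3) unfolding dist_real_def by linarith
  qed
qed

theorem psi_asymptotic: "(\<lambda>n. psi n / real n) \<longlonglongrightarrow> 1"
  by (rule mono_tauberian) (auto intro: monoI psi_mono summable_psi_error)

text \<open>Chebyshev's function without the prime 2, since Goldbach partitions use odd primes; the
  missing \<open>ln 2\<close> is absorbed in the error term.\<close>

definition theta :: "nat \<Rightarrow> real" where
  "theta n = (\<Sum>p | prime p \<and> odd p \<and> p \<le> n. ln (real p))"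

text \<open>Beyond the odd primes, psi counts 2 and powers \<open>p ^ j\<close> with
  \<open>j \<ge> 2\<close>. The latter have \<open>p \<le> sqrt n\<close> and
  \<open>j \<le> log 2 n\<close>, and each number weighs at most \<open>ln n\<close>.\<close>

lemma psi_theta_diff:
  assumes n: "n \<ge> 2"
  shows "theta n \<le> psi n" "psi n - theta n \<le> ((sqrt (real n) + 1) * (log 2 (real n) + 1) + 1) * ln (real n)"
proof -
  define P where "P = {p. prime p \<and> odd p \<and> p \<le> n}"
  have PS: "P \<subseteq> {..n}" by (auto simp: P_def)
  have th: "theta n = (\<Sum>p\<in>P. mangoldt p)" by (auto simp: theta_def P_def intro!: sum.cong)
  have ps: "psi n = (\<Sum>p\<in>P. mangoldt p) + (\<Sum>k\<in>{..n}-P. mangoldt k)"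
    unfolding psi_def using PS by (simp add: sum.subset_diff add.commute)
  have "(\<Sum>k\<in>{..n}-P. mangoldt k :: real) \<ge> 0" by (intro sum_nonneg mangoldt_nonneg)
  then show "theta n \<le> psi n" using th ps by simp
  define s where "s = nat \<lfloor>sqrt (real n)\<rfloor>"
  define l where "l = nat \<lfloor>log 2 (real n)\<rfloor>"
  define X where "X = {k. k \<le> n \<and> primepow k \<and> k \<notin> P}"
  have X: "X \<subseteq> insert 2 ((\<lambda>(p,j). p ^ j) ` ({1..s} \<times> {0..l}))"
  proof
    fix k assume k: "k \<in> X"
    then obtain p j where pj: "prime p" "j > 0" "k = p ^ j" by (auto simp: X_def primepow_def)
    show "k \<in> insert 2 ((\<lambda>(p,j). p ^ j) ` ({1..s} \<times> {0..l}))"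
    proof (cases "j = 1")
      case True
      then have "k = 2" using k pj prime_odd_nat[of p] prime_ge_2_nat[of p] by (auto simp: X_def P_def intro: ccontr)
      then show ?thesis by simp
    next
      case False
      have p2: "p \<ge> 2" using pj prime_ge_2_nat by auto
      have "p ^ 2 \<le> p ^ j" using False pj p2 by (intro power_increasing) auto
      then have "p ^ 2 \<le> n" using k pj by (auto simp: X_def)
      then have "real p ^ 2 \<le> real n" by (metis of_nat_le_iff of_nat_power)
      then have "real p \<le> sqrt (real n)" by (rule real_le_rsqrt)
      then have 1: "p \<le> s" by (simp add: s_def le_nat_iff le_floor_iff)
      have "2 ^ j \<le> p ^ j" using p2 by (intro power_mono) auto
      moreover have "p ^ j \<le> n" using k pj by (simp add: X_def)
      ultimately have "2 ^ j \<le> n" by (rule order_trans)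
      then have "(2::real) ^ j \<le> real n" by (metis of_nat_le_iff of_nat_power of_nat_numeral)
      then have "real j \<le> log 2 (real n)" using n by (simp add: le_log_iff powr_realpow)
      then have 2: "j \<le> l" by (simp add: l_def le_nat_iff le_floor_iff)
      show ?thesis using 1 2 p2 pj by (auto intro!: image_eqI[of _ _ "(p, j)"])
    qed
  qed
  have "card X \<le> card (insert 2 ((\<lambda>(p,j). p ^ j) ` ({1..s} \<times> {0..l})))" using X by (intro card_mono) auto
  also have "\<dots> \<le> card ((\<lambda>(p,j). p ^ j) ` ({1..s} \<times> {0..l})) + 1" by (simp add: card_insert_if)
  also have "\<dots> \<le> card ({1..s} \<times> {0..l}) + 1" by (intro add_right_mono card_image_le) auto
  finally have "card X \<le> s * (l + 1) + 1" by simp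
  then have "real (card X) \<le> real (s * (l + 1) + 1)" by (simp only: of_nat_le_iff)
  also have "\<dots> = real s * (real l + 1) + 1" by (simp add: distrib_left)
  also have "\<dots> \<le> (sqrt (real n) + 1) * (log 2 (real n) + 1) + 1"
  proof -
    have "real s \<le> sqrt (real n)" by (simp add: s_def)
    moreover have "real l \<le> log 2 (real n)" using n by (simp add: l_def)
    ultimately show ?thesis by (intro add_right_mono mult_mono) auto
  qed
  finally have cX: "real (card X) \<le> (sqrt (real n) + 1) * (log 2 (real n) + 1) + 1" .
  have "psi n - theta n = (\<Sum>k\<in>{..n}-P. mangoldt k)" using th ps by simp
  also have "\<dots> = (\<Sum>k\<in>X. mangoldt k)"
    by (rule sum.mono_neutral_right) (auto simp: X_def mangoldt_def)
  also have "\<dots> \<le> (\<Sum>k\<in>X. ln (real n))"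
  proof (rule sum_mono)
    fix k assume k: "k \<in> X"
    then have "k > 0" "k \<le> n" by (auto simp: X_def intro!: Nat.gr0I)
    then show "mangoldt k \<le> ln (real n)" using mangoldt_le[of k] by (force intro: order_trans)
  qed
  also have "\<dots> = real (card X) * ln (real n)" by simp
  also have "\<dots> \<le> ((sqrt (real n) + 1) * (log 2 (real n) + 1) + 1) * ln (real n)"
    using cX n by (intro mult_right_mono) auto
  finally show "psi n - theta n \<le> ((sqrt (real n) + 1) * (log 2 (real n) + 1) + 1) * ln (real n)" .
qed

theorem theta_asymptotic: "(\<lambda>n. theta n / real n) \<longlonglongrightarrow> 1"
proof -
  have "(\<lambda>n. (psi n - theta n) / real n) \<longlonglongrightarrow> 0"
  proof (rule tendsto_sandwich)
    show "\<forall>\<^sub>F n in sequentially. 0 \<le> (psi n - theta n) / real n"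
      using psi_theta_diff(1) by (intro eventually_sequentiallyI[of 2]) auto
    show "\<forall>\<^sub>F n in sequentially. (psi n - theta n) / real n \<le> ((sqrt (real n) + 1) * (log 2 (real n) + 1) + 1) * ln (real n) / real n"
      using psi_theta_diff(2) by (intro eventually_sequentiallyI[of 2] divide_right_mono) auto
    show "(\<lambda>n. ((sqrt (real n) + 1) * (log 2 (real n) + 1) + 1) * ln (real n) / real n) \<longlonglongrightarrow> 0"
      unfolding log_def by real_asymp
  qed auto
  from tendsto_diff[OF psi_asymptotic this] show ?thesis by (simp add: diff_divide_distrib)
qed

section \<open>Moments of sums of two primes\<close>

text \<open>Stolz-Cesaro, with the hypothesis multiplied out so that \<open>b n\<close> may vanish.
  The head below N is swallowed by the divergent denominator.\<close>

lemma tendsto_weighted_sum_ratio: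
  fixes f b :: "nat \<Rightarrow> real"
  assumes b: "\<And>n. b n \<ge> 0" and B: "filterlim (\<lambda>n. \<Sum>m<n. b m) at_top sequentially"
    and f: "\<And>e. e > 0 \<Longrightarrow> \<forall>\<^sub>F n in sequentially. \<bar>f n - c * b n\<bar> \<le> e * b n"
  shows "(\<lambda>n. (\<Sum>m<n. f m) / (\<Sum>m<n. b m)) \<longlonglongrightarrow> c"
proof (rule tendstoI)
  fix e :: real assume e: "e > 0"
  obtain N where N: "\<And>n. n \<ge> N \<Longrightarrow> \<bar>f n - c * b n\<bar> \<le> e / 2 * b n"
    using f[of "e/2"] e by (auto simp: eventually_sequentially)
  define D where "D = (\<Sum>m<N. \<bar>f m - c * b m\<bar>)"
  have "\<forall>\<^sub>F n in sequentially. (\<Sum>m<n. b m) > max 0 (2 * D / e)"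
    using B unfolding filterlim_at_top_dense by (rule spec)
  then show "\<forall>\<^sub>F n in sequentially. dist ((\<Sum>m<n. f m) / (\<Sum>m<n. b m)) c < e"
    using eventually_ge_at_top[of N]
  proof eventually_elim
    case (elim n)
    define S where "S = (\<Sum>m<n. b m)"
    have S: "S > 0" "2 * D / e < S" using elim by (auto simp: S_def)
    have "\<bar>(\<Sum>m<n. f m) - c * S\<bar> = \<bar>\<Sum>m<n. f m - c * b m\<bar>"
      by (simp add: S_def sum_subtractf sum_distrib_left)
    also have "\<dots> \<le> (\<Sum>m<n. \<bar>f m - c * b m\<bar>)" by (rule sum_abs)
    also have "\<dots> = D + (\<Sum>m=N..<n. \<bar>f m - c * b m\<bar>)"
      unfolding D_def lessThan_atLeast0 using elim by (intro sum.atLeastLessThan_concat[symmetric]) auto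
    also have "\<dots> \<le> D + (\<Sum>m=N..<n. e / 2 * b m)" using N by (intro add_left_mono sum_mono) auto
    also have "\<dots> \<le> D + (\<Sum>m<n. e / 2 * b m)" using b e by (intro add_left_mono sum_mono2) auto
    also have "\<dots> = D + e / 2 * S" by (simp add: S_def sum_distrib_left)
    also have "\<dots> < e * S" using S e by (simp add: field_simps)
    finally have "\<bar>(\<Sum>m<n. f m) - c * S\<bar> < e * S" .
    moreover have "(\<Sum>m<n. f m) / S - c = ((\<Sum>m<n. f m) - c * S) / S" using S by (simp add: field_simps)
    ultimately have "\<bar>(\<Sum>m<n. f m) / S - c\<bar> < e" using S by (simp add: field_simps)
    then show ?case by (simp add: dist_real_def S_def)
  qed
qed

lemma tendsto_sum_power:
  fixes f :: "nat \<Rightarrow> real"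
  assumes f: "(\<lambda>n. f n / real n ^ r) \<longlonglongrightarrow> c"
  shows "(\<lambda>n. (\<Sum>m<n. f m) / real n ^ Suc r) \<longlonglongrightarrow> c / real (Suc r)"
proof -
  text \<open>Comparing with the increments of \<open>n ^ Suc r\<close> makes the weights telescope.\<close>
  define b where "b = (\<lambda>n. real (Suc n) ^ Suc r - real n ^ Suc r)"
  have B: "(\<Sum>m<n. b m) = real n ^ Suc r" for n by (induction n) (auto simp: b_def)
  have b0: "b n \<ge> 0" for n unfolding b_def using power_mono[of "real n" "real (Suc n)" "Suc r"] by simp
  \<comment> \<open>Makes \<open>b n\<close> positive for n > 0, so that quotients by it can be
    multiplied out.\<close>
  have blow: "b n \<ge> real (Suc r) * real n ^ r" for n
  proof -
    have "b n = (real (Suc n) - real n) * (\<Sum>i<Suc r. real (Suc n) ^ i * real n ^ (Suc r - Suc i))"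
      unfolding b_def using power_diff_sumr2[of "real (Suc n)" "Suc r" "real n"] by (simp only: mult.commute)
    also have "\<dots> = (\<Sum>i<Suc r. real (Suc n) ^ i * real n ^ (r - i))" by simp
    also have "\<dots> \<ge> (\<Sum>i<Suc r. real n ^ i * real n ^ (r - i))"
      by (intro sum_mono mult_right_mono power_mono) auto
    finally show ?thesis by (simp add: power_add[symmetric] del: sum.lessThan_Suc)
  qed
  \<comment> \<open>\<open>b n\<close> is a sum of r + 1 products; divided by \<open>n ^ r\<close>
    they become powers of \<open>1 + 1 / n\<close>, each tending to 1.\<close>
  have blim: "(\<lambda>n. b n / real n ^ r) \<longlonglongrightarrow> real (Suc r)"
  proof -
    have "(\<lambda>n. \<Sum>i<Suc r. (1 + 1 / real n) ^ i) \<longlonglongrightarrow> (\<Sum>i<Suc r. (1 + 0) ^ i)"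
      by (intro tendsto_intros)
    moreover have "\<forall>\<^sub>F n in sequentially. (\<Sum>i<Suc r. (1 + 1 / real n) ^ i) = b n / real n ^ r"
    proof (rule eventually_sequentiallyI[of 1])
      fix n :: nat assume n: "1 \<le> n"
      have "b n = (real (Suc n) - real n) * (\<Sum>i<Suc r. real (Suc n) ^ i * real n ^ (Suc r - Suc i))"
        unfolding b_def using power_diff_sumr2[of "real (Suc n)" "Suc r" "real n"] by (simp only: mult.commute)
      also have "\<dots> = (\<Sum>i<Suc r. real (Suc n) ^ i * real n ^ (r - i))" by simp
      also have "\<dots> = (\<Sum>i<Suc r. real n ^ r * (1 + 1 / real n) ^ i)"
      proof (rule sum.cong[OF refl])
        fix i assume i: "i \<in> {..<Suc r}"
        have "real (Suc n) = real n * (1 + 1 / real n)" using n by (simp add: field_simps)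
        then have "real (Suc n) ^ i = real n ^ i * (1 + 1 / real n) ^ i" by (simp only: power_mult_distrib)
        moreover have "real n ^ i * real n ^ (r - i) = real n ^ r" using i by (simp add: power_add[symmetric])
        ultimately show "real (Suc n) ^ i * real n ^ (r - i) = real n ^ r * (1 + 1 / real n) ^ i" by (simp add: mult_ac)
      qed
      finally show "(\<Sum>i<Suc r. (1 + 1 / real n) ^ i) = b n / real n ^ r"
        using n by (simp only: sum_distrib_left[symmetric]) simp
    qed
    ultimately show ?thesis using tendsto_cong by force
  qed
  have "(\<lambda>n. (\<Sum>m<n. f m) / (\<Sum>m<n. b m)) \<longlonglongrightarrow> c / real (Suc r)"
  proof (rule tendsto_weighted_sum_ratio[OF b0])
    show "filterlim (\<lambda>n. \<Sum>m<n. b m) at_top sequentially" unfolding B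
      by (intro filterlim_pow_at_top filterlim_real_sequentially) auto
    fix e :: real assume e: "e > 0"
    have "(\<lambda>n. (f n / real n ^ r) / (b n / real n ^ r)) \<longlonglongrightarrow> c / real (Suc r)"
      by (intro tendsto_divide f blim) auto
    then have "\<forall>\<^sub>F n in sequentially. dist ((f n / real n ^ r) / (b n / real n ^ r)) (c / real (Suc r)) < e"
      using e by (rule tendstoD)
    then show "\<forall>\<^sub>F n in sequentially. \<bar>f n - c / real (Suc r) * b n\<bar> \<le> e * b n"
      using eventually_gt_at_top[of 0]
    proof eventually_elim
      case (elim n)
      have "real (Suc r) * real n ^ r > 0" using elim by simp
      then have bn: "b n > 0" using blow[of n] by linarith
      have eq: "(f n / real n ^ r) / (b n / real n ^ r) = f n / b n" using elim by simp
      have "\<bar>f n / b n - c / real (Suc r)\<bar> \<le> e" using elim unfolding eq dist_real_def by linarith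
      then have "\<bar>f n / b n - c / real (Suc r)\<bar> * b n \<le> e * b n" using bn by (intro mult_right_mono) auto
      moreover have "\<bar>f n / b n - c / real (Suc r)\<bar> * b n = \<bar>(f n / b n - c / real (Suc r)) * b n\<bar>"
        using bn by (simp add: abs_mult)
      moreover have "(f n / b n - c / real (Suc r)) * b n = f n - c / real (Suc r) * b n"
        using bn by (simp add: left_diff_distrib)
      ultimately show ?case by simp
    qed
  qed
  then show ?thesis unfolding B .
qed

text \<open>Ordered pairs, unlike \<open>goldbach_partitions\<close>, so that sums can be carried
  out one prime at a time.\<close>

definition odd_prime_pairs :: "nat \<Rightarrow> (nat \<times> nat) set" where
  "odd_prime_pairs X = {(p, q). prime p \<and> prime q \<and> odd p \<and> odd q \<and> p + q \<le> X}"

lemma odd_prime_pairs_subset: "odd_prime_pairs X \<subseteq> {..X} \<times> {..X}"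
  by (auto simp: odd_prime_pairs_def)

lemma finite_odd_prime_pairs [simp]: "finite (odd_prime_pairs X)"
  using odd_prime_pairs_subset by (rule finite_subset) auto

definition log_weight :: "nat \<times> nat \<Rightarrow> real" where
  "log_weight pq = ln (real (fst pq)) * ln (real (snd pq))"

definition weighted_moment :: "nat \<Rightarrow> nat \<Rightarrow> real" where
  "weighted_moment k X = (\<Sum>pq\<in>odd_prime_pairs X. log_weight pq * real (fst pq + snd pq) ^ k)"

lemma log_weight_nonneg: "pq \<in> odd_prime_pairs X \<Longrightarrow> log_weight pq \<ge> 0"
  by (auto simp: odd_prime_pairs_def log_weight_def prime_gt_0_nat Suc_leI intro!: mult_nonneg_nonneg)

lemma theta_mono: "mono theta"
  unfolding theta_def by (intro monoI sum_mono2) (auto simp: prime_gt_0_nat Suc_leI)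

lemma theta_nonneg: "theta n \<ge> 0"
  unfolding theta_def by (intro sum_nonneg) (auto simp: prime_gt_0_nat Suc_leI)

lemma weighted_moment_0_eq:
  "weighted_moment 0 X = (\<Sum>p | prime p \<and> odd p \<and> p \<le> X. ln (real p) * theta (X - p))"
proof -
  have fin: "finite {p::nat. Q p \<and> R p \<and> p \<le> n}" for Q R n by (rule finite_subset[of _ "{..n}"]) auto
  have "odd_prime_pairs X = (SIGMA p:{p. prime p \<and> odd p \<and> p \<le> X}. {q. prime q \<and> odd q \<and> q \<le> X - p})"
    by (auto simp: odd_prime_pairs_def)
  then have "weighted_moment 0 X = (\<Sum>(p,q)\<in>(SIGMA p:{p. prime p \<and> odd p \<and> p \<le> X}. {q. prime q \<and> odd q \<and> q \<le> X - p}). ln (real p) * ln (real q))"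
    by (simp add: weighted_moment_def log_weight_def case_prod_unfold)
  also have "\<dots> = (\<Sum>p | prime p \<and> odd p \<and> p \<le> X. \<Sum>q | prime q \<and> odd q \<and> q \<le> X - p. ln (real p) * ln (real q))"
    using fin by (subst sum.Sigma) auto
  finally show ?thesis by (simp add: theta_def sum_distrib_left)
qed

text \<open>The counterpart of \<open>weighted_moment_0_eq\<close> with \<open>theta (X - p)\<close>
  replaced by its main term: p is counted once for each m with \<open>p \<le> m\<close> and
  \<open>m < X\<close>.\<close>

lemma sum_theta_eq:
  "(\<Sum>m<X. theta m) = (\<Sum>p | prime p \<and> odd p \<and> p \<le> X. ln (real p) * real (X - p))"
proof -
  define P where "P = {p. prime p \<and> odd p \<and> p \<le> X}"
  have fin: "finite P" unfolding P_def by (rule finite_subset[of _ "{..X}"]) auto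
  have "(\<Sum>m<X. theta m) = (\<Sum>m<X. \<Sum>p\<in>P. if p \<le> m then ln (real p) else 0)"
  proof (rule sum.cong[OF refl])
    fix m assume "m \<in> {..<X}"
    then have "{p. prime p \<and> odd p \<and> p \<le> m} = {p\<in>P. p \<le> m}" by (auto simp: P_def)
    then show "theta m = (\<Sum>p\<in>P. if p \<le> m then ln (real p) else 0)"
      unfolding theta_def using fin by (simp only: sum.inter_filter)
  qed
  also have "\<dots> = (\<Sum>p\<in>P. \<Sum>m<X. if p \<le> m then ln (real p) else 0)" by (rule sum.swap)
  also have "\<dots> = (\<Sum>p\<in>P. ln (real p) * real (X - p))"
  proof (rule sum.cong[OF refl])
    fix p
    have "(\<Sum>m<X. if p \<le> m then ln (real p) else 0) = (\<Sum>m\<in>{m\<in>{..<X}. p \<le> m}. ln (real p))"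
      by (simp only: sum.inter_filter finite_lessThan)
    also have "{m\<in>{..<X}. p \<le> m} = {p..<X}" by auto
    finally show "(\<Sum>m<X. if p \<le> m then ln (real p) else 0) = ln (real p) * real (X - p)" by simp
  qed
  finally show ?thesis by (simp add: P_def)
qed

text \<open>By \<open>tendsto_sum_power\<close> the sum of \<open>theta m\<close> over
  \<open>m < X\<close> is about \<open>X^2 / 2\<close>. The moment differs from it by the errors
  \<open>theta (X - p) - (X - p)\<close>, so the prime number theorem enters a second time.\<close>

lemma weighted_moment_0_asymptotic: "(\<lambda>X. weighted_moment 0 X / real X ^ 2) \<longlonglongrightarrow> 1 / 2"
proof -
  have 1: "(\<lambda>X. (\<Sum>m<X. theta m) / real X ^ 2) \<longlonglongrightarrow> 1 / 2"
    using tendsto_sum_power[of theta 1 1] theta_asymptotic by (simp add: numeral_2_eq_2)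
  have "(\<lambda>X. (weighted_moment 0 X - (\<Sum>m<X. theta m)) / real X ^ 2) \<longlonglongrightarrow> 0"
  proof (rule tendstoI)
    fix e :: real assume e: "e > 0"
    have "\<forall>\<^sub>F n in sequentially. dist (theta n / real n) 1 < e / 4"
      using theta_asymptotic e by (intro tendstoD) auto
    then obtain N where N: "\<And>n. n \<ge> N \<Longrightarrow> dist (theta n / real n) 1 < e / 4" by (auto simp: eventually_sequentially)
    \<comment> \<open>K covers the arguments below N, which occur as \<open>X - p\<close> for p
      close to X. It costs only \<open>theta X * K\<close>, which is linear in X.\<close>
    define K where "K = theta N + real N"
    have bd: "\<bar>theta m - real m\<bar> \<le> e / 4 * real m + K" for m
    proof (cases "m \<ge> N \<and> m > 0")
      case True
      then have "\<bar>theta m / real m - 1\<bar> * real m \<le> e / 4 * real m" using N[of m] by (intro mult_right_mono) (auto simp: dist_real_def)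
      moreover have "\<bar>theta m / real m - 1\<bar> * real m = \<bar>(theta m / real m - 1) * real m\<bar>" by (simp add: abs_mult)
      moreover have "(theta m / real m - 1) * real m = theta m - real m" using True by (simp add: left_diff_distrib)
      moreover have "K \<ge> 0" using theta_nonneg by (simp add: K_def)
      ultimately show ?thesis by simp
    next
      case False
      then have "m \<le> N" by auto
      then have "theta m \<le> theta N" using theta_mono by (simp add: monoD)
      moreover have "real m \<le> real N" using \<open>m \<le> N\<close> by simp
      moreover have "0 \<le> e / 4 * real m" using e by simp
      ultimately show ?thesis using theta_nonneg[of m] theta_nonneg[of N] unfolding K_def by linarith
    qed
    have K0: "K \<ge> 0" using theta_nonneg by (simp add: K_def)
    have "\<bar>weighted_moment 0 X - (\<Sum>m<X. theta m)\<bar> \<le> theta X * (e / 4 * real X + K)" for X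
    proof -
      have "\<bar>weighted_moment 0 X - (\<Sum>m<X. theta m)\<bar> = \<bar>\<Sum>p | prime p \<and> odd p \<and> p \<le> X. ln (real p) * (theta (X - p) - real (X - p))\<bar>"
        unfolding weighted_moment_0_eq sum_theta_eq by (simp add: sum_subtractf right_diff_distrib)
      also have "\<dots> \<le> (\<Sum>p | prime p \<and> odd p \<and> p \<le> X. \<bar>ln (real p) * (theta (X - p) - real (X - p))\<bar>)" by (rule sum_abs)
      also have "\<dots> \<le> (\<Sum>p | prime p \<and> odd p \<and> p \<le> X. ln (real p) * (e / 4 * real X + K))"
      proof (rule sum_mono)
        fix p assume "p \<in> {p. prime p \<and> odd p \<and> p \<le> X}"
        then have p: "ln (real p) \<ge> 0" by (auto simp: prime_gt_0_nat Suc_leI)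
        have "e / 4 * real (X - p) \<le> e / 4 * real X" using e by (intro mult_left_mono) auto
        then have "\<bar>theta (X - p) - real (X - p)\<bar> \<le> e / 4 * real X + K" using bd[of "X - p"] by linarith
        then show "\<bar>ln (real p) * (theta (X - p) - real (X - p))\<bar> \<le> ln (real p) * (e / 4 * real X + K)"
          unfolding abs_mult using p by (intro mult_mono) auto
      qed
      also have "\<dots> = theta X * (e / 4 * real X + K)" by (simp add: theta_def sum_distrib_right)
      finally show ?thesis .
    qed
    note * = this
    have "(\<lambda>X. theta X / real X * (e / 4 + K / real X)) \<longlonglongrightarrow> 1 * (e / 4 + 0)"
      by (intro tendsto_intros theta_asymptotic)
    moreover have "1 * (e / 4 + 0) < e" using e by simp
    ultimately have "\<forall>\<^sub>F X in sequentially. theta X / real X * (e / 4 + K / real X) < e"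
      by (rule order_tendstoD(2))
    then show "\<forall>\<^sub>F X in sequentially. dist ((weighted_moment 0 X - (\<Sum>m<X. theta m)) / real X ^ 2) 0 < e"
      using eventually_gt_at_top[of 0]
    proof eventually_elim
      case (elim X)
      have "\<bar>weighted_moment 0 X - (\<Sum>m<X. theta m)\<bar> / real X ^ 2 \<le> theta X * (e / 4 * real X + K) / real X ^ 2"
        using * by (intro divide_right_mono) auto
      also have "\<dots> = theta X / real X * (e / 4 + K / real X)" using elim by (simp add: field_simps power2_eq_square)
      also have "\<dots> < e" using elim by simp
      finally show ?case by (simp add: dist_real_def)
    qed
  qed
  from tendsto_add[OF this 1] show ?thesis by (simp add: diff_divide_distrib)
qed

text \<open>Write \<open>X ^ k - (p + q) ^ k\<close> as the telescoping sum of the increments of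
  \<open>m ^ k\<close> from \<open>p + q\<close> to X, and interchange the two sums.\<close>

lemma weighted_moment_abel:
  "weighted_moment k X = real X ^ k * weighted_moment 0 X - (\<Sum>m<X. (real (Suc m) ^ k - real m ^ k) * weighted_moment 0 m)"
proof -
  define g where "g = (\<lambda>m. real (Suc m) ^ k - real m ^ k)"
  have tele: "(\<Sum>m=s..<X. g m) = real X ^ k - real s ^ k" if "s \<le> X" for s
    unfolding g_def using sum_Suc_diff'[OF that, of "\<lambda>m. real m ^ k"] by simp
  have "(\<Sum>m<X. g m * weighted_moment 0 m) = (\<Sum>m<X. \<Sum>pq\<in>odd_prime_pairs X. if fst pq + snd pq \<le> m then g m * log_weight pq else 0)"
  proof (rule sum.cong[OF refl])
    fix m assume "m \<in> {..<X}"
    then have eq: "odd_prime_pairs m = {pq\<in>odd_prime_pairs X. fst pq + snd pq \<le> m}" by (auto simp: odd_prime_pairs_def)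
    have "g m * weighted_moment 0 m = (\<Sum>pq\<in>odd_prime_pairs m. g m * log_weight pq)"
      by (simp add: weighted_moment_def sum_distrib_left)
    also have "\<dots> = (\<Sum>pq\<in>odd_prime_pairs X. if fst pq + snd pq \<le> m then g m * log_weight pq else 0)"
      unfolding eq by (rule sum.inter_filter) simp
    finally show "g m * weighted_moment 0 m = (\<Sum>pq\<in>odd_prime_pairs X. if fst pq + snd pq \<le> m then g m * log_weight pq else 0)" .
  qed
  also have "\<dots> = (\<Sum>pq\<in>odd_prime_pairs X. \<Sum>m<X. if fst pq + snd pq \<le> m then g m * log_weight pq else 0)" by (rule sum.swap)
  also have "\<dots> = (\<Sum>pq\<in>odd_prime_pairs X. log_weight pq * (real X ^ k - real (fst pq + snd pq) ^ k))"
  proof (rule sum.cong[OF refl])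
    fix pq assume "pq \<in> odd_prime_pairs X"
    then have le: "fst pq + snd pq \<le> X" by (auto simp: odd_prime_pairs_def)
    have "(\<Sum>m<X. if fst pq + snd pq \<le> m then g m * log_weight pq else 0) = (\<Sum>m\<in>{m\<in>{..<X}. fst pq + snd pq \<le> m}. g m * log_weight pq)"
      by (simp only: sum.inter_filter finite_lessThan)
    also have "{m\<in>{..<X}. fst pq + snd pq \<le> m} = {fst pq + snd pq..<X}" by auto
    finally show "(\<Sum>m<X. if fst pq + snd pq \<le> m then g m * log_weight pq else 0) = log_weight pq * (real X ^ k - real (fst pq + snd pq) ^ k)"
      using tele[OF le] by (simp add: sum_distrib_right[symmetric])
  qed
  also have "\<dots> = real X ^ k * weighted_moment 0 X - weighted_moment k X"
    by (simp add: weighted_moment_def right_diff_distrib sum_subtractf sum_distrib_left sum_distrib_right mult.commute)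
  finally show ?thesis unfolding g_def by simp
qed

text \<open>In \<open>weighted_moment_abel\<close> the first term contributes 1/2 and the sum
  \<open>k / (2 * (k + 2))\<close>; the difference is \<open>1 / (k + 2)\<close>.\<close>

lemma weighted_moment_asymptotic:
  assumes "k \<le> 2"
  shows "(\<lambda>X. weighted_moment k X / real X ^ (k + 2)) \<longlonglongrightarrow> 1 / real (k + 2)"
proof -
  have "(\<lambda>m. (real (Suc m) ^ k - real m ^ k) * real m / real m ^ k) \<longlonglongrightarrow> real k"
  proof -
    \<comment> \<open>Concrete exponents let \<open>real_asymp\<close> decide the limit; mean and
      variance involve just these three moments.\<close>
    have "k = 0 \<or> k = 1 \<or> k = 2" using assms by auto
    then show ?thesis
    proof (elim disjE)
      assume "k = 0" then show ?thesis by simp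
    next
      assume k: "k = 1" show ?thesis unfolding k by real_asymp
    next
      assume k: "k = 2" show ?thesis unfolding k by real_asymp
    qed
  qed
  from tendsto_mult[OF this weighted_moment_0_asymptotic]
  have "(\<lambda>m. (real (Suc m) ^ k - real m ^ k) * real m / real m ^ k * (weighted_moment 0 m / real m ^ 2)) \<longlonglongrightarrow> real k / 2"
    by simp
  moreover have "(real (Suc m) ^ k - real m ^ k) * real m / real m ^ k * (weighted_moment 0 m / real m ^ 2)
     = (real (Suc m) ^ k - real m ^ k) * weighted_moment 0 m / real m ^ (k + 1)" for m
    by (cases "m = 0") (simp_all add: field_simps power2_eq_square weighted_moment_def odd_prime_pairs_def)
  ultimately have "(\<lambda>m. (real (Suc m) ^ k - real m ^ k) * weighted_moment 0 m / real m ^ (k + 1)) \<longlonglongrightarrow> real k / 2" by simp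
  from tendsto_sum_power[OF this]
  have "(\<lambda>X. (\<Sum>m<X. (real (Suc m) ^ k - real m ^ k) * weighted_moment 0 m) / real X ^ (k + 2)) \<longlonglongrightarrow> real k / 2 / real (k + 2)"
    by simp
  from tendsto_diff[OF weighted_moment_0_asymptotic this]
  have "(\<lambda>X. weighted_moment 0 X / real X ^ 2 - (\<Sum>m<X. (real (Suc m) ^ k - real m ^ k) * weighted_moment 0 m) / real X ^ (k + 2)) \<longlonglongrightarrow> 1 / 2 - real k / 2 / real (k + 2)" .
  moreover have "1 / 2 - real k / 2 / real (k + 2) = 1 / real (k + 2)" by (simp add: field_simps)
  moreover have "\<forall>\<^sub>F X in sequentially. weighted_moment 0 X / real X ^ 2 - (\<Sum>m<X. (real (Suc m) ^ k - real m ^ k) * weighted_moment 0 m) / real X ^ (k + 2)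
     = weighted_moment k X / real X ^ (k + 2)"
  proof (rule eventually_sequentiallyI[of 1])
    fix X :: nat assume "1 \<le> X"
    then show "weighted_moment 0 X / real X ^ 2 - (\<Sum>m<X. (real (Suc m) ^ k - real m ^ k) * weighted_moment 0 m) / real X ^ (k + 2)
     = weighted_moment k X / real X ^ (k + 2)"
      by (subst weighted_moment_abel[of k X]) (simp add: diff_divide_distrib power_add power2_eq_square)
  qed
  ultimately show ?thesis using tendsto_cong by force
qed

section \<open>Removal of the logarithmic weights\<close>

definition pair_moment :: "nat \<Rightarrow> nat \<Rightarrow> real" where
  "pair_moment k X = (\<Sum>pq\<in>odd_prime_pairs X. real (fst pq + snd pq) ^ k)"

lemma weighted_moment_le:
  assumes "X > 0"
  shows "weighted_moment k X \<le> ln (real X) ^ 2 * pair_moment k X"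
  unfolding weighted_moment_def pair_moment_def sum_distrib_left
proof (rule sum_mono)
  fix pq assume pq: "pq \<in> odd_prime_pairs X"
  then have "0 < fst pq" "0 < snd pq" "fst pq \<le> X" "snd pq \<le> X" by (auto simp: odd_prime_pairs_def prime_gt_0_nat)
  then have "log_weight pq \<le> ln (real X) ^ 2" unfolding log_weight_def power2_eq_square using assms by (intro mult_mono) auto
  then show "log_weight pq * real (fst pq + snd pq) ^ k \<le> ln (real X) ^ 2 * real (fst pq + snd pq) ^ k" by (intro mult_right_mono) auto
qed

text \<open>Pairs with a component below \<open>X powr (1 - \<delta>)\<close> are few, and all others have logarithmic
  weight at least \<open>(1 - \<delta>)\<^sup>2 * ln X ^ 2\<close>.\<close>
lemma pair_moment_le:
  assumes X: "X > 0" and \<delta>: "0 < \<delta>" "\<delta> < 1"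
  shows "(1 - \<delta>)^2 * ln (real X) ^ 2 * pair_moment k X
    \<le> weighted_moment k X + ln (real X) ^ 2 * (2 * (real X powr (1 - \<delta>) + 1) * (real X + 1) * real X ^ k)"
proof -
  define Y where "Y = real X powr (1 - \<delta>)"
  define y where "y = nat \<lfloor>Y\<rfloor>"
  have Y: "Y > 0" "real y \<le> Y" using X by (auto simp: Y_def y_def)
  have lnY: "ln Y = (1 - \<delta>) * ln (real X)" using X by (simp add: Y_def ln_powr)
  define Bad where "Bad = {pq\<in>odd_prime_pairs X. real (fst pq) < Y \<or> real (snd pq) < Y}"
  have small: "real p < Y \<Longrightarrow> p \<le> y" for p using Y by (simp add: y_def le_nat_iff le_floor_iff)
  have "Bad \<subseteq> {..y} \<times> {..X} \<union> {..X} \<times> {..y}"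
    using odd_prime_pairs_subset[of X] small by (auto simp: Bad_def)
  then have "card Bad \<le> card ({..y} \<times> {..X} \<union> {..X} \<times> {..y})" by (intro card_mono) auto
  also have "\<dots> \<le> card ({..y} \<times> {..X}) + card ({..X} \<times> {..y})" by (rule card_Un_le)
  finally have "card Bad \<le> 2 * (y + 1) * (X + 1)" by (simp add: algebra_simps)
  then have "real (card Bad) \<le> real (2 * (y + 1) * (X + 1))" by (simp only: of_nat_le_iff)
  also have "\<dots> = 2 * (real y + 1) * (real X + 1)" by (simp add: algebra_simps)
  also have "\<dots> \<le> 2 * (Y + 1) * (real X + 1)" using Y by (intro mult_right_mono mult_left_mono) auto
  finally have cB: "real (card Bad) \<le> 2 * (Y + 1) * (real X + 1)" .
  define L where "L = ln (real X)"
  have L: "L \<ge> 0" using X by (simp add: L_def)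
  have "(1 - \<delta>)^2 * L^2 * pair_moment k X = (\<Sum>pq\<in>odd_prime_pairs X. (1 - \<delta>)^2 * L^2 * real (fst pq + snd pq) ^ k)"
    by (simp add: pair_moment_def sum_distrib_left)
  also have "\<dots> \<le> (\<Sum>pq\<in>odd_prime_pairs X. log_weight pq * real (fst pq + snd pq) ^ k + (if pq \<in> Bad then L^2 * real X ^ k else 0))"
  proof (rule sum_mono)
    fix pq assume pq: "pq \<in> odd_prime_pairs X"
    then have pos: "0 < fst pq" "0 < snd pq" "fst pq + snd pq \<le> X" by (auto simp: odd_prime_pairs_def prime_gt_0_nat)
    have lw: "log_weight pq * real (fst pq + snd pq) ^ k \<ge> 0" using log_weight_nonneg[OF pq] by simp
    show "(1 - \<delta>)^2 * L^2 * real (fst pq + snd pq) ^ k \<le> log_weight pq * real (fst pq + snd pq) ^ k + (if pq \<in> Bad then L^2 * real X ^ k else 0)"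
    \<comment> \<open>A bad pair is paid for in full by the extra term, a good one by its own
      weight.\<close>
    proof (cases "pq \<in> Bad")
      case True
      have "(1 - \<delta>)^2 * L^2 * real (fst pq + snd pq) ^ k \<le> 1 * L^2 * real X ^ k"
        using \<delta> pos L by (intro mult_mono power_mono power_le_one) auto
      then show ?thesis using True lw by simp
    next
      case False
      then have "Y \<le> real (fst pq)" "Y \<le> real (snd pq)" using pq by (auto simp: Bad_def)
      then have "ln Y \<le> ln (real (fst pq))" "ln Y \<le> ln (real (snd pq))" using Y pos by auto
      then have "ln Y * ln Y \<le> log_weight pq" unfolding log_weight_def using lnY L \<delta> pos unfolding L_def by (intro mult_mono) auto
      moreover have "ln Y * ln Y = (1 - \<delta>)^2 * L^2" unfolding lnY L_def by (simp add: power2_eq_square)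
      ultimately show ?thesis using False by (simp add: mult_right_mono)
    qed
  qed
  also have "\<dots> = weighted_moment k X + (\<Sum>pq\<in>odd_prime_pairs X. if pq \<in> Bad then L^2 * real X ^ k else 0)"
    by (simp add: weighted_moment_def sum.distrib)
  also have "(\<Sum>pq\<in>odd_prime_pairs X. if pq \<in> Bad then L^2 * real X ^ k else 0) = real (card Bad) * (L^2 * real X ^ k)"
  proof -
    have "odd_prime_pairs X \<inter> Bad = Bad" by (auto simp: Bad_def)
    then show ?thesis by (simp add: sum.If_cases)
  qed
  also have "\<dots> \<le> (2 * (Y + 1) * (real X + 1)) * (L^2 * real X ^ k)" using cB by (intro mult_right_mono) auto
  finally show ?thesis by (simp add: L_def Y_def mult_ac)
qed

text \<open>\<open>weighted_moment_le\<close> gives the lower bound. For the upper one, a > c leaves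
  room for some \<open>\<delta>\<close> with \<open>(1 - \<delta>)^2 * a > c\<close>; for this fixed
  \<open>\<delta>\<close> the bad pairs number at most about \<open>X powr (2 - \<delta>)\<close>,
  negligible against \<open>X^2\<close> even with the logarithms.\<close>

lemma pair_moment_asymptotic:
  assumes k: "k \<le> 2"
  shows "(\<lambda>X. ln (real X) ^ 2 * pair_moment k X / real X ^ (k + 2)) \<longlonglongrightarrow> 1 / real (k + 2)"
proof -
  define c where "c = 1 / real (k + 2)"
  define f where "f = (\<lambda>X. ln (real X) ^ 2 * pair_moment k X / real X ^ (k + 2))"
  define g where "g = (\<lambda>X. weighted_moment k X / real X ^ (k + 2))"
  have g: "g \<longlonglongrightarrow> c" unfolding g_def c_def by (rule weighted_moment_asymptotic[OF k])
  have c: "c > 0" by (simp add: c_def)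
  have "f \<longlonglongrightarrow> c"
  proof (rule order_tendstoI)
    fix a assume "a < c"
    then have "\<forall>\<^sub>F X in sequentially. a < g X" using g by (rule order_tendstoD(1)[rotated])
    then show "\<forall>\<^sub>F X in sequentially. a < f X" using eventually_gt_at_top[of 0]
    proof eventually_elim
      case (elim X)
      have "g X \<le> f X" unfolding f_def g_def using weighted_moment_le[OF elim(2), of k] by (intro divide_right_mono) auto
      then show ?case using elim by simp
    qed
  next
    fix a assume a: "a > c"
    have "((\<lambda>\<delta>::real. (1 - \<delta>)^2 * a) \<longlongrightarrow> (1 - 0)^2 * a) (at_right 0)" by (intro tendsto_intros)
    then have "\<forall>\<^sub>F \<delta> in at_right (0::real). (1 - \<delta>)^2 * a > c" using a by (intro order_tendstoD(1)) auto
    moreover have "\<forall>\<^sub>F \<delta> in at_right (0::real). \<delta> \<in> {0<..<1}" by (rule eventually_at_right_real) auto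
    ultimately have "\<forall>\<^sub>F \<delta> in at_right (0::real). (1 - \<delta>)^2 * a > c \<and> \<delta> \<in> {0<..<1}" by (rule eventually_conj)
    then obtain \<delta> :: real where \<delta>: "(1 - \<delta>)^2 * a > c" "0 < \<delta>" "\<delta> < 1"
      using eventually_happens'[OF trivial_limit_at_right_real] by force
    have "(\<lambda>X. ln (real X) ^ 2 * (2 * (real X powr (1 - \<delta>) + 1) * (real X + 1)) / real X ^ 2) \<longlonglongrightarrow> 0"
      using \<delta> by real_asymp
    from tendsto_add[OF g this] 
    have "(\<lambda>X. g X + ln (real X) ^ 2 * (2 * (real X powr (1 - \<delta>) + 1) * (real X + 1)) / real X ^ 2) \<longlonglongrightarrow> c" by simp
    then have "\<forall>\<^sub>F X in sequentially. g X + ln (real X) ^ 2 * (2 * (real X powr (1 - \<delta>) + 1) * (real X + 1)) / real X ^ 2 < (1 - \<delta>)^2 * a"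
      using \<delta>(1) by (rule order_tendstoD(2))
    then show "\<forall>\<^sub>F X in sequentially. f X < a" using eventually_gt_at_top[of 0]
    proof eventually_elim
      case (elim X)
      have "(1 - \<delta>)^2 * f X = (1 - \<delta>)^2 * ln (real X) ^ 2 * pair_moment k X / real X ^ (k + 2)" by (simp add: f_def)
      also have "\<dots> \<le> (weighted_moment k X + ln (real X) ^ 2 * (2 * (real X powr (1 - \<delta>) + 1) * (real X + 1) * real X ^ k)) / real X ^ (k + 2)"
        using pair_moment_le[OF elim(2) \<delta>(2,3), of k] by (intro divide_right_mono) auto
      also have "\<dots> = g X + ln (real X) ^ 2 * (2 * (real X powr (1 - \<delta>) + 1) * (real X + 1)) / real X ^ 2"
        using elim by (simp add: g_def add_divide_distrib power_add power2_eq_square)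
      also have "\<dots> < (1 - \<delta>)^2 * a" using elim by simp
      finally show ?case using \<delta> by simp
    qed
  qed
  then show ?thesis by (simp add: f_def c_def)
qed

section \<open>Moments of the maximum of two uniform variables\<close>

abbreviation unit_uniform :: "real measure" where
  "unit_uniform \<equiv> uniform_measure lborel {0<..<1}"

lemma prob_space_unit_uniform: "prob_space unit_uniform"
  by (rule prob_space_uniform_measure) auto

text \<open>The end points are null, so the interval may be closed; the integral on the right is
  then accessible to the fundamental theorem of calculus.\<close>

lemma integral_unit_uniform:
  fixes f :: "real \<Rightarrow> real"
  assumes "continuous_on {0..1} f" "f \<in> borel_measurable borel"
  shows "integral\<^sup>L unit_uniform f = integral {0..1} f"
proof -
  have "unit_uniform = density lborel (\<lambda>x. ennreal (indicator {0<..<1} x))"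
    unfolding uniform_measure_def by (intro density_cong) (auto simp: indicator_def)
  then have "integral\<^sup>L unit_uniform f = (LINT x|lborel. indicator {0<..<1} x *\<^sub>R f x)"
    using assms(2) by (simp add: integral_density)
  also have "\<dots> = (LINT x|lborel. indicator {0..1} x *\<^sub>R f x)"
  proof (rule integral_cong_AE)
    show "AE x in lborel. indicator {0<..<1} x *\<^sub>R f x = indicator {0..1} x *\<^sub>R f x"
      using AE_lborel_singleton[of 0] AE_lborel_singleton[of 1] by eventually_elim (auto simp: indicator_def)
  qed (use assms(2) in auto)
  also have "\<dots> = integral {0..1} f"
    using set_borel_integral_eq_integral(2)[of "{0..1}" f] borel_integrable_atLeastAtMost'[OF assms(1)]
    by (simp add: set_lebesgue_integral_def)
  finally show ?thesis .
qed

lemma integral_FTC_real: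
  fixes F f :: "real \<Rightarrow> real"
  assumes "a \<le> b" "\<And>x. (F has_real_derivative f x) (at x)"
  shows "integral {a..b} f = F b - F a"
  using assms by (intro integral_unique fundamental_theorem_of_calculus)
    (auto simp: has_real_derivative_iff_has_vector_derivative[symmetric] intro: has_field_derivative_at_within)

lemma borel_measurable_unit_uniform_pair:
  "f \<in> borel_measurable borel \<Longrightarrow> f \<in> borel_measurable (unit_uniform \<Otimes>\<^sub>M unit_uniform)"
  by (simp add: measurable_cong_sets[OF sets_pair_measure_cong[of unit_uniform borel unit_uniform borel] refl] borel_prod)

lemma has_real_derivative_power_Suc_over:
  "((\<lambda>x. x ^ Suc k / real (Suc k)) has_real_derivative x ^ k) (at x)"
  using DERIV_cdivide[OF DERIV_pow[of "Suc k" x], of "real (Suc k)"] by (simp del: power_Suc of_nat_Suc)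

text \<open>The bound holds on the open unit square, which has full measure; on a probability space
  this gives integrability, and Fubini follows.\<close>

lemma U_space_integral:
  fixes f :: "real \<times> real \<Rightarrow> real"
  assumes f: "f \<in> borel_measurable borel" and bd: "\<And>x. x \<in> {0<..<1} \<times> {0<..<1} \<Longrightarrow> \<bar>f x\<bar> \<le> B"
  shows "integrable U_space f" "integral\<^sup>L U_space f = (LINT x|unit_uniform. LINT y|unit_uniform. f (x, y))"
proof -
  interpret P: prob_space unit_uniform by (rule prob_space_unit_uniform)
  interpret PP: pair_prob_space unit_uniform unit_uniform ..
  have m: "f \<in> borel_measurable (unit_uniform \<Otimes>\<^sub>M unit_uniform)"
    using f by (rule borel_measurable_unit_uniform_pair)
  have ae: "AE x in unit_uniform. x \<in> {0<..<1}" by (rule AE_uniform_measureI) auto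
  have "AE x in unit_uniform \<Otimes>\<^sub>M unit_uniform. x \<in> {0<..<1} \<times> {0<..<1}"
  proof (rule PP.AE_pair_measure)
    show "{x \<in> space (unit_uniform \<Otimes>\<^sub>M unit_uniform). x \<in> {0<..<1} \<times> {0<..<1}} \<in> sets (unit_uniform \<Otimes>\<^sub>M unit_uniform)"
      by measurable
    show "AE x in unit_uniform. AE y in unit_uniform. (x, y) \<in> {0<..<1} \<times> {0<..<1}"
      using ae by eventually_elim (use ae in \<open>auto elim!: eventually_mono\<close>)
  qed
  then have "AE x in unit_uniform \<Otimes>\<^sub>M unit_uniform. norm (f x) \<le> B" by eventually_elim (use bd in auto)
  then have i: "integrable (unit_uniform \<Otimes>\<^sub>M unit_uniform) f" using m by (intro PP.P.integrable_const_bound) auto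
  then show "integrable U_space f" by (simp add: U_space_def)
  show "integral\<^sup>L U_space f = (LINT x|unit_uniform. LINT y|unit_uniform. f (x, y))"
    unfolding U_space_def using PP.integral_fst'[OF i] by simp
qed

lemma T_measurable [measurable]: "T \<in> borel_measurable borel"
  unfolding T_def[abs_def] by (intro borel_measurable_continuous_onI continuous_intros)

lemma integral_max_power:
  fixes x :: real
  assumes "0 \<le> x" "x \<le> 1"
  shows "integral {0..1} (\<lambda>y. max x y ^ k) = x ^ Suc k + (1 - x ^ Suc k) / real (Suc k)"
proof -
  have "integral {0..1} (\<lambda>y. max x y ^ k) = integral {0..x} (\<lambda>y. max x y ^ k) + integral {x..1} (\<lambda>y. max x y ^ k)"
    using assms by (intro Henstock_Kurzweil_Integration.integral_combine[symmetric] integrable_continuous_interval continuous_intros) auto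
  also have "integral {0..x} (\<lambda>y. max x y ^ k) = integral {0..x} (\<lambda>y. x ^ k)" by (rule integral_cong) auto
  also have "\<dots> = x ^ Suc k" using assms by simp
  also have "integral {x..1} (\<lambda>y. max x y ^ k) = integral {x..1} (\<lambda>y. y ^ k)" by (rule integral_cong) auto
  also have "\<dots> = 1 ^ Suc k / real (Suc k) - x ^ Suc k / real (Suc k)"
    using assms by (intro integral_FTC_real has_real_derivative_power_Suc_over)
  finally show ?thesis by (simp add: diff_divide_distrib)
qed

text \<open>Iterated integration, the inner integral being split at y = x. The value agrees with the
  density \<open>2 * x\<close> of T on (0,1).\<close>

lemma T_moment:
  shows "integrable U_space (\<lambda>u. T u ^ k)" "integral\<^sup>L U_space (\<lambda>u. T u ^ k) = 2 / real (k + 2)"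
proof -
  have bd: "\<bar>T u ^ k\<bar> \<le> 1" if "u \<in> {0<..<1} \<times> {0<..<1}" for u
    using that by (auto simp: T_def max_def power_abs intro!: power_le_one)
  show "integrable U_space (\<lambda>u. T u ^ k)"
    by (rule U_space_integral[OF _ bd]) auto
  have "integral\<^sup>L U_space (\<lambda>u. T u ^ k) = (LINT x|unit_uniform. LINT y|unit_uniform. T (x, y) ^ k)"
    by (rule U_space_integral[OF _ bd]) auto
  also have "\<dots> = (LINT x|unit_uniform. x ^ Suc k + (1 - x ^ Suc k) / real (Suc k))"
  proof (rule integral_cong_AE)
    show "(\<lambda>x. x ^ Suc k + (1 - x ^ Suc k) / real (Suc k)) \<in> borel_measurable unit_uniform" by simp
    have "AE x in unit_uniform. x \<in> {0<..<1}" by (rule AE_uniform_measureI) auto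
    then show "AE x in unit_uniform. (LINT y|unit_uniform. T (x, y) ^ k) = x ^ Suc k + (1 - x ^ Suc k) / real (Suc k)"
    proof eventually_elim
      case (elim x)
      have "(LINT y|unit_uniform. T (x, y) ^ k) = integral {0..1} (\<lambda>y. max x y ^ k)"
        unfolding T_def fst_conv snd_conv by (rule integral_unit_uniform) (auto intro!: continuous_intros)
      then show ?case using elim by (simp add: integral_max_power)
    qed
    interpret P: prob_space unit_uniform by (rule prob_space_unit_uniform)
    have "(\<lambda>(x, y). T (x, y) ^ k) \<in> borel_measurable (unit_uniform \<Otimes>\<^sub>M unit_uniform)"
      using borel_measurable_unit_uniform_pair[of "\<lambda>u. T u ^ k"] by (simp add: case_prod_unfold)
    then show "(\<lambda>x. LINT y|unit_uniform. T (x, y) ^ k) \<in> borel_measurable unit_uniform"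
      by (rule P.borel_measurable_lebesgue_integral)
  qed
  also have "\<dots> = integral {0..1} (\<lambda>x. x ^ Suc k + (1 - x ^ Suc k) / real (Suc k))"
    by (rule integral_unit_uniform) (auto intro!: continuous_intros)
  \<comment> \<open>The antiderivative is \<open>x ^ (k + 2) / (k + 2) + (x - x ^ (k + 2) / (k + 2))
    / (k + 1)\<close>.\<close>
  also have "\<dots> = (1 ^ Suc (Suc k) / real (Suc (Suc k)) + (1 - 1 ^ Suc (Suc k) / real (Suc (Suc k))) / real (Suc k))
      - (0 ^ Suc (Suc k) / real (Suc (Suc k)) + (0 - 0 ^ Suc (Suc k) / real (Suc (Suc k))) / real (Suc k))"
    by (intro integral_FTC_real DERIV_add DERIV_diff DERIV_cdivide DERIV_ident has_real_derivative_power_Suc_over) simp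
  also have "\<dots> = 2 / real (k + 2)"
  proof -
    have "1 / (a + 1) + (1 - 1 / (a + 1)) / a = 2 / (a + 1)" if "a > 0" for a :: real
      using that by (simp add: divide_simps)
    from this[of "real (Suc k)"] show ?thesis by (simp add: add.commute)
  qed
  finally show "integral\<^sup>L U_space (\<lambda>u. T u ^ k) = 2 / real (k + 2)" .
qed

lemma mu_T_eq: "mu_T = 2 / 3"
  using T_moment(2)[of 1] by (simp add: mu_T_def)

lemma sigma2_T_eq: "sigma2_T = 1 / 18"
proof -
  interpret P: prob_space unit_uniform by (rule prob_space_unit_uniform)
  interpret PP: pair_prob_space unit_uniform unit_uniform ..
  interpret U: prob_space U_space unfolding U_space_def by unfold_locales
  have v: "U.variance T = U.expectation (\<lambda>u. (T u)\<^sup>2) - (U.expectation T)\<^sup>2"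
    using T_moment(1)[of 1] T_moment(1)[of 2] by (intro U.variance_eq) auto
  have e1: "U.expectation T = 2 / 3" using mu_T_eq by (simp add: mu_T_def)
  have e2: "U.expectation (\<lambda>u. (T u)\<^sup>2) = 1 / 2" using T_moment(2)[of 2] by simp
  have "U.variance T = 1 / 18" unfolding v e2 unfolding e1 by (simp add: power2_eq_square)
  then show ?thesis by (simp only: sigma2_T_def mu_T_def)
qed

section \<open>Goldbach partitions\<close>

lemma goldbach_partitions_eq: "goldbach_partitions n = {pq\<in>odd_prime_pairs (2 * n). fst pq \<le> snd pq}"
proof -
  have "p > 2" if "prime p" "odd p" for p :: nat
    using that prime_ge_2_nat[of p] by (cases "p = 2") auto
  then have "4 < p + q" if "prime p" "odd p" "prime q" "odd q" for p q :: nat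
    using that by (metis add_strict_mono numeral_Bit0)
  then show ?thesis by (auto simp: goldbach_partitions_def odd_prime_pairs_def)
qed

lemma finite_goldbach_partitions [simp]: "finite (goldbach_partitions n)"
  by (simp add: goldbach_partitions_eq)

definition goldbach_moment :: "nat \<Rightarrow> nat \<Rightarrow> real" where
  "goldbach_moment k n = (\<Sum>pq\<in>goldbach_partitions n. real (fst pq + snd pq) ^ k)"

text \<open>Swapping maps the pairs with \<open>p \<le> q\<close> onto those with
  \<open>q \<le> p\<close>; the two halves cover all ordered pairs and overlap in the
  diagonal.\<close>

lemma goldbach_moment_eq:
  "2 * goldbach_moment k n = pair_moment k (2 * n) + (\<Sum>pq\<in>{pq\<in>odd_prime_pairs (2 * n). fst pq = snd pq}. real (fst pq + snd pq) ^ k)"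
proof -
  define A where "A = odd_prime_pairs (2 * n)"
  define f where "f = (\<lambda>pq::nat\<times>nat. real (fst pq + snd pq) ^ k)"
  have fin: "finite A" by (simp add: A_def)
  have "(\<Sum>pq\<in>{pq\<in>A. fst pq \<le> snd pq}. f pq) = (\<Sum>pq\<in>{pq\<in>A. snd pq \<le> fst pq}. f pq)"
    by (rule sum.reindex_bij_witness[of _ prod.swap prod.swap]) (auto simp: A_def odd_prime_pairs_def f_def add.commute)
  then have "2 * (\<Sum>pq\<in>{pq\<in>A. fst pq \<le> snd pq}. f pq) = (\<Sum>pq\<in>{pq\<in>A. fst pq \<le> snd pq}. f pq) + (\<Sum>pq\<in>{pq\<in>A. snd pq \<le> fst pq}. f pq)" by simp
  also have "\<dots> = (\<Sum>pq\<in>{pq\<in>A. fst pq \<le> snd pq} \<union> {pq\<in>A. snd pq \<le> fst pq}. f pq) + (\<Sum>pq\<in>{pq\<in>A. fst pq \<le> snd pq} \<inter> {pq\<in>A. snd pq \<le> fst pq}. f pq)"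
    using fin by (intro sum.union_inter[symmetric]) auto
  also have "{pq\<in>A. fst pq \<le> snd pq} \<union> {pq\<in>A. snd pq \<le> fst pq} = A" by auto
  also have "{pq\<in>A. fst pq \<le> snd pq} \<inter> {pq\<in>A. snd pq \<le> fst pq} = {pq\<in>A. fst pq = snd pq}" by auto
  finally show ?thesis by (simp add: goldbach_moment_def goldbach_partitions_eq pair_moment_def A_def f_def)
qed

text \<open>The diagonal has at most \<open>2 * n + 1\<close> pairs, negligible against the order
  \<open>n^2 / ln n ^ 2\<close> of all pairs; half of \<open>pair_moment_asymptotic\<close> along
  \<open>X = 2 * n\<close> remains.\<close>

lemma goldbach_moment_asymptotic:
  assumes "k \<le> 2"
  shows "(\<lambda>n. ln (real (2 * n)) ^ 2 * goldbach_moment k n / real (2 * n) ^ (k + 2)) \<longlonglongrightarrow> 1 / (2 * real (k + 2))"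
proof -
  define D where "D = (\<lambda>n. (\<Sum>pq\<in>{pq\<in>odd_prime_pairs (2 * n). fst pq = snd pq}. real (fst pq + snd pq) ^ k))"
  have D0: "D n \<ge> 0" for n unfolding D_def by (intro sum_nonneg) auto
  have D1: "D n \<le> (real (2 * n) + 1) * real (2 * n) ^ k" for n
  proof -
    have "{pq\<in>odd_prime_pairs (2 * n). fst pq = snd pq} \<subseteq> (\<lambda>p. (p, p)) ` {..2*n}"
      by (auto simp: odd_prime_pairs_def)
    then have "card {pq\<in>odd_prime_pairs (2 * n). fst pq = snd pq} \<le> card {..2*n}"
      by (meson card_image_le card_mono finite_atMost finite_imageI order_trans)
    then have c: "real (card {pq\<in>odd_prime_pairs (2 * n). fst pq = snd pq}) \<le> real (2 * n) + 1"
      by simp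
    have "D n \<le> (\<Sum>pq\<in>{pq\<in>odd_prime_pairs (2 * n). fst pq = snd pq}. real (2 * n) ^ k)"
      unfolding D_def by (intro sum_mono power_mono) (auto simp: odd_prime_pairs_def)
    also have "\<dots> = real (card {pq\<in>odd_prime_pairs (2 * n). fst pq = snd pq}) * real (2 * n) ^ k" by simp
    also have "\<dots> \<le> (real (2 * n) + 1) * real (2 * n) ^ k" using c by (intro mult_right_mono) auto
    finally show ?thesis .
  qed
  have dlim: "(\<lambda>n. ln (real (2 * n)) ^ 2 * D n / real (2 * n) ^ (k + 2)) \<longlonglongrightarrow> 0"
  proof (rule tendsto_sandwich)
    show "\<forall>\<^sub>F n in sequentially. 0 \<le> ln (real (2 * n)) ^ 2 * D n / real (2 * n) ^ (k + 2)" using D0 by auto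
    show "\<forall>\<^sub>F n in sequentially. ln (real (2 * n)) ^ 2 * D n / real (2 * n) ^ (k + 2) \<le> ln (real (2 * n)) ^ 2 * (real (2 * n) + 1) / real (2 * n) ^ 2"
    proof (rule eventually_sequentiallyI[of 1])
      fix n :: nat assume n: "1 \<le> n"
      have "ln (real (2 * n)) ^ 2 * D n / real (2 * n) ^ (k + 2) \<le> ln (real (2 * n)) ^ 2 * ((real (2 * n) + 1) * real (2 * n) ^ k) / real (2 * n) ^ (k + 2)"
        using D1 by (intro divide_right_mono mult_left_mono) auto
      also have "\<dots> = ln (real (2 * n)) ^ 2 * (real (2 * n) + 1) / real (2 * n) ^ 2" using n by (simp add: power_add power2_eq_square)
      finally show "ln (real (2 * n)) ^ 2 * D n / real (2 * n) ^ (k + 2) \<le> ln (real (2 * n)) ^ 2 * (real (2 * n) + 1) / real (2 * n) ^ 2" .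
    qed
    show "(\<lambda>n. ln (real (2 * n)) ^ 2 * (real (2 * n) + 1) / real (2 * n) ^ 2) \<longlonglongrightarrow> 0" by real_asymp
  qed auto
  have "filterlim (\<lambda>n::nat. 2 * n) sequentially sequentially" by (rule mult_nat_left_at_top) simp
  from filterlim_compose[OF pair_moment_asymptotic[OF assms] this]
  have "(\<lambda>n. ln (real (2 * n)) ^ 2 * pair_moment k (2 * n) / real (2 * n) ^ (k + 2)) \<longlonglongrightarrow> 1 / real (k + 2)" .
  from tendsto_mult_right[OF tendsto_add[OF this dlim], of "1/2"]
  have L: "(\<lambda>n. (ln (real (2 * n)) ^ 2 * pair_moment k (2 * n) / real (2 * n) ^ (k + 2) + ln (real (2 * n)) ^ 2 * D n / real (2 * n) ^ (k + 2)) * (1 / 2)) \<longlonglongrightarrow> (1 / real (k + 2) + 0) * (1 / 2)" .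
  have eq: "(ln (real (2 * n)) ^ 2 * pair_moment k (2 * n) / real (2 * n) ^ (k + 2) + ln (real (2 * n)) ^ 2 * D n / real (2 * n) ^ (k + 2)) * (1 / 2)
      = ln (real (2 * n)) ^ 2 * goldbach_moment k n / real (2 * n) ^ (k + 2)" for n
  proof -
    have g: "goldbach_moment k n = (pair_moment k (2 * n) + D n) / 2" using goldbach_moment_eq[of k n] by (simp add: D_def)
    show ?thesis unfolding g by (simp add: add_divide_distrib distrib_left del: of_nat_mult)
  qed
  have lim: "(1 / real (k + 2) + 0) * (1 / 2) = 1 / (2 * real (k + 2))" by (simp add: mult.commute)
  show ?thesis using L unfolding eq lim .
qed

section \<open>Expectation and variance of G\<close>

lemma goldbach_partitions_nonempty: "n \<ge> 3 \<Longrightarrow> goldbach_partitions n \<noteq> {}"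
proof -
  assume n: "n \<ge> 3"
  \<comment> \<open>6 = 3 + 3 is the smallest sum of two odd primes, so the uniform distribution
    makes sense from n = 3 on.\<close>
  have "(3, 3) \<in> goldbach_partitions n" using n by (simp add: goldbach_partitions_def)
  then show ?thesis by blast
qed

lemma expectation_G_power:
  assumes "n \<ge> 3"
  shows "measure_pmf.expectation (Goldbach_P n) (\<lambda>pq. G pq ^ k) = goldbach_moment k n / (2 ^ k * goldbach_moment 0 n)"
proof -
  have "measure_pmf.expectation (Goldbach_P n) (\<lambda>pq. G pq ^ k) = (\<Sum>pq\<in>goldbach_partitions n. G pq ^ k) / real (card (goldbach_partitions n))"
    unfolding Goldbach_P_def using goldbach_partitions_nonempty[OF assms] by (intro integral_pmf_of_set) auto
  also have "(\<Sum>pq\<in>goldbach_partitions n. G pq ^ k) = goldbach_moment k n / 2 ^ k"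
    by (simp add: goldbach_moment_def G_def power_divide sum_divide_distrib)
  finally show ?thesis by (simp add: goldbach_moment_def)
qed

text \<open>The quotient of the moments k and 0 cancels \<open>ln (2 * n) ^ 2\<close>, and the
  \<open>2 ^ k\<close> from G turns \<open>(2 * n) ^ k\<close> into \<open>n ^ k\<close>. The limit
  is \<open>1 / (2 * (k + 2))\<close> divided by 1/4.\<close>

lemma expectation_G_power_asymptotic:
  assumes "k \<le> 2"
  shows "(\<lambda>n. measure_pmf.expectation (Goldbach_P n) (\<lambda>pq. G pq ^ k) / real n ^ k) \<longlonglongrightarrow> 2 / real (k + 2)"
proof -
  define f where "f = (\<lambda>k n. ln (real (2 * n)) ^ 2 * goldbach_moment k n / real (2 * n) ^ (k + 2))"
  have "(\<lambda>n. f k n / f 0 n) \<longlonglongrightarrow> (1 / (2 * real (k + 2))) / (1 / (2 * real (0 + 2)))"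
    unfolding f_def using assms by (intro tendsto_divide goldbach_moment_asymptotic) auto
  moreover have "\<forall>\<^sub>F n in sequentially. f k n / f 0 n = measure_pmf.expectation (Goldbach_P n) (\<lambda>pq. G pq ^ k) / real n ^ k"
  proof (rule eventually_sequentiallyI[of 3])
    fix n :: nat assume n: "3 \<le> n"
    define l x where "l = ln (real (2 * n))" and "x = real (2 * n)"
    have lx: "l > 0" "x > 0" using n by (auto simp: l_def x_def)
    have "f k n / f 0 n = goldbach_moment k n / (x ^ k * goldbach_moment 0 n)"
    proof -
      \<comment> \<open>The cases \<open>b = 0\<close> and \<open>w = 0\<close> hold by the
        convention that division by 0 gives 0.\<close>
      have "(y * a / (w * z)) / (y * b / z) = a / (w * b)" if "y \<noteq> 0" "z \<noteq> 0" for y a w z b :: real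
        using that by (cases "b = 0"; cases "w = 0") (auto simp: field_simps)
      moreover have "f k n / f 0 n = (l^2 * goldbach_moment k n / (x^k * x^2)) / (l^2 * goldbach_moment 0 n / x^2)"
        unfolding f_def l_def x_def power_add by simp
      moreover have "l^2 \<noteq> 0" "x^2 \<noteq> 0" using lx by auto
      ultimately show ?thesis by presburger
    qed
    moreover have "x ^ k = 2 ^ k * real n ^ k" by (simp add: x_def power_mult_distrib)
    ultimately show "f k n / f 0 n = measure_pmf.expectation (Goldbach_P n) (\<lambda>pq. G pq ^ k) / real n ^ k"
      unfolding expectation_G_power[OF n] by (simp add: mult_ac)
  qed
  ultimately have "(\<lambda>n. measure_pmf.expectation (Goldbach_P n) (\<lambda>pq. G pq ^ k) / real n ^ k) \<longlonglongrightarrow> (1 / (2 * real (k + 2))) / (1 / (2 * real (0 + 2)))"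
    using tendsto_cong by force
  moreover have "(1 / (2 * real (k + 2))) / (1 / (2 * real (0 + 2))) = 2 / real (k + 2)" by (simp add: divide_simps)
  ultimately show ?thesis by (simp only:)
qed

theorem theorem1:
  shows "((\<lambda>n. measure_pmf.expectation (Goldbach_P n) G / real n) \<longlongrightarrow> mu_T) sequentially
         \<and> mu_T = 2 / 3
         \<and> ((\<lambda>n. measure_pmf.variance (Goldbach_P n) G / (real n)\<^sup>2) \<longlongrightarrow> sigma2_T) sequentially
         \<and> sigma2_T = 1 / 18"
proof (intro conjI mu_T_eq sigma2_T_eq)
  have 1: "(\<lambda>n. measure_pmf.expectation (Goldbach_P n) G / real n) \<longlonglongrightarrow> 2 / 3"
    using expectation_G_power_asymptotic[of 1] by simp
  then show "(\<lambda>n. measure_pmf.expectation (Goldbach_P n) G / real n) \<longlonglongrightarrow> mu_T" by (simp add: mu_T_eq)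
  have 2: "(\<lambda>n. measure_pmf.expectation (Goldbach_P n) (\<lambda>pq. (G pq)\<^sup>2) / (real n)\<^sup>2) \<longlonglongrightarrow> 1 / 2"
    using expectation_G_power_asymptotic[of 2] by simp
  have "(\<lambda>n. measure_pmf.expectation (Goldbach_P n) (\<lambda>pq. (G pq)\<^sup>2) / (real n)\<^sup>2 - (measure_pmf.expectation (Goldbach_P n) G / real n)\<^sup>2) \<longlonglongrightarrow> 1 / 2 - (2 / 3)\<^sup>2"
    by (intro tendsto_intros 1 2)
  moreover have "(1 / 2 - (2 / 3)\<^sup>2 :: real) = 1 / 18" by (simp add: power2_eq_square)
  moreover have "\<forall>\<^sub>F n in sequentially. measure_pmf.expectation (Goldbach_P n) (\<lambda>pq. (G pq)\<^sup>2) / (real n)\<^sup>2 - (measure_pmf.expectation (Goldbach_P n) G / real n)\<^sup>2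
     = measure_pmf.variance (Goldbach_P n) G / (real n)\<^sup>2"
  \<comment> \<open>From n = 3 on the support is finite and given by the partitions, so G and its
    square are integrable and the variance is the second moment minus the squared mean.\<close>
  proof (rule eventually_sequentiallyI[of 3])
    fix n :: nat assume n: "3 \<le> n"
    have "finite (set_pmf (Goldbach_P n))" using goldbach_partitions_nonempty[OF n] by (simp add: Goldbach_P_def)
    then have "measure_pmf.variance (Goldbach_P n) G = measure_pmf.expectation (Goldbach_P n) (\<lambda>pq. (G pq)\<^sup>2) - (measure_pmf.expectation (Goldbach_P n) G)\<^sup>2"
      by (intro measure_pmf.variance_eq integrable_measure_pmf_finite)
    then show "measure_pmf.expectation (Goldbach_P n) (\<lambda>pq. (G pq)\<^sup>2) / (real n)\<^sup>2 - (measure_pmf.expectation (Goldbach_P n) G / real n)\<^sup>2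
     = measure_pmf.variance (Goldbach_P n) G / (real n)\<^sup>2"
      by (simp add: diff_divide_distrib power_divide)
  qed
  ultimately show "(\<lambda>n. measure_pmf.variance (Goldbach_P n) G / (real n)\<^sup>2) \<longlonglongrightarrow> sigma2_T"
    unfolding sigma2_T_eq using tendsto_cong by force
qed

end
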